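(* For any integer $d\ge 1$, any Lebesgue measurable sets $E_1,E_2\subset\mathbb R^d$ with finite Lebesgue measures, and any $\tau>0$, $$\int_{\mathbb R^d}\min(\mathbf 1_{E_1}*\mathbf 1_{E_2},\tau)\ \ge\ \int_{\mathbb R^d}\min(\mathbf 1_{E_1^\star}*\mathbf 1_{E_2^\star},\tau).$$
   Context: $\mathbf 1_E$ is the indicator function of $E$ and $*$ is convolution on $\mathbb R^d$; integrals are with respect to Lebesgue measure. For $E\subset\mathbb R^d$ measurable with finite Lebesgue measure $|E|$, $E^\star$ is the closed ball centered at the origin with $|E^\star|=|E|$. *)

theory Defs
  imports "HOL-Analysis.Analysis"
begin

definition convolve ::
  "('a::euclidean_space \<Rightarrow> real) \<Rightarrow> ('a \<Rightarrow> real) \<Rightarrow> 'a \<Rightarrow> real"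
  where "convolve f g x = (LINT y|lebesgue. f (x - y) * g y)"

(* For a null set E the radius is 0, so that the rearrangement is the degenerate ball {0}. *)
definition ball_rearrangement :: "'a::euclidean_space set \<Rightarrow> 'a set"
  where "ball_rearrangement E =
    cball 0 (THE r. 0 \<le> r \<and> measure lebesgue (cball (0::'a) r) = measure lebesgue E)"

lemma ex1_ball_rearrangement_radius:
  fixes E :: "'a::euclidean_space set"
  shows "\<exists>!r. 0 \<le> r \<and> measure lebesgue (cball (0::'a) r) = measure lebesgue E"
proof -
  let ?n = "DIM('a)" and ?c = "unit_ball_vol (real DIM('a))"
  have n: "0 < ?n" by simp
  have c: "0 < ?c" by simp
  then have c0: "?c \<noteq> 0" by (rule less_imp_neq[symmetric])
  have vol: "measure lebesgue (cball (0::'a) r) = ?c * r ^ ?n" if "0 \<le> r" for r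
    using content_cball[OF that, of "0::'a"] by simp
  show ?thesis
  proof (rule ex1I[of _ "root ?n (measure lebesgue E / ?c)"])
    have "0 \<le> measure lebesgue E / ?c" using c by simp
    then have "0 \<le> root ?n (measure lebesgue E / ?c)"
      and "root ?n (measure lebesgue E / ?c) ^ ?n = measure lebesgue E / ?c"
      by (simp_all add: real_root_pow_pos2)
    then show "0 \<le> root ?n (measure lebesgue E / ?c) \<and>
        measure lebesgue (cball (0::'a) (root ?n (measure lebesgue E / ?c))) = measure lebesgue E"
      using vol c0 by simp
  next
    fix r assume r: "0 \<le> r \<and> measure lebesgue (cball (0::'a) r) = measure lebesgue E"
    then have "r ^ ?n = measure lebesgue E / ?c"
      using vol[of r] c0 by (simp add: field_simps)
    then show "r = root ?n (measure lebesgue E / ?c)"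
      using r real_root_pos_unique[OF n, of r] by simp
  qed
qed

lemma measure_ball_rearrangement:
  "measure lebesgue (ball_rearrangement E) = measure lebesgue E"
  unfolding ball_rearrangement_def
  using theI'[OF ex1_ball_rearrangement_radius[of E]] by blast

end

theory Submission
  imports Defs
begin

text \<open>
The truncated integral is dual to the trilinear form \<open>I(A, B, C) = |{(x, y) \<in> A \<times>
B. x + y \<in> C}|\<close>: since \<open>min f \<tau> = f - max 0 (f - \<tau>)\<close>, and the
integral of \<open>max 0 (f - \<tau>)\<close> is the maximum over \<open>C\<close> of the integral
of \<open>f - \<tau>\<close> over \<open>C\<close>, attained at \<open>C = {f > \<tau>}\<close>,
the truncated integral of \<open>f = 1_A * 1_B\<close> equals \<open>|A| |B|\<close> minus the
maximum of \<open>I(A, B, C) - \<tau> |C|\<close> over \<open>C\<close>. An operation on sets that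
preserves measure and does not decrease \<open>I\<close> therefore does not increase the truncated
integral (\<open>truncated_integral_steiner_le\<close>).

Steiner symmetrization is such an operation. By Tonelli along lines, this reduces to the
Riesz-Sobolev inequality on the real line (\<open>riesz_sobolev_line\<close>). There, split
\<open>A \<times> B\<close> into a rectangle, with \<open>A\<close> cut at the top and
\<open>B\<close> at the bottom by mass \<open>t\<close>, and its L-shaped complement. Each
antidiagonal \<open>x + y = z\<close> meets the complement in measure at most \<open>t\<close>,
because along it the complement lies entirely in one arm of the L. So \<open>I(A, B, C) \<le> (|A|
- t) (|B| - t) + t |C|\<close>, and for intervals with a suitable \<open>t\<close> this is an
equality.

It remains to reach the ball. Let \<open>K\<close> be the ball with \<open>|K| = |A|\<close>. On
each line, symmetrization decreases \<open>|A - K|\<close> by the smaller of the lengths of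
\<open>A - K\<close> and \<open>K - A\<close> on that line. Averaging over all translations gives
a vector \<open>z\<close> that moves a part of \<open>A - K\<close> of measure at least \<open>c
|A - K|\<^sup>2\<close> into \<open>K - A\<close>, and symmetrizing in the direction of
\<open>z\<close> gains at least that much, with \<open>c\<close> depending only on a ball that
contains \<open>A\<close> and \<open>K\<close> (\<open>exists_improving_direction\<close>).
Symmetrizing a pair \<open>(A, B)\<close> in the direction that is good for the worse of the two
sets, one comes arbitrarily close to the pair of balls without raising the truncated integral,
which is continuous in measure (\<open>truncated_integral_balls_le_bounded\<close>). Exhaustion by
bounded sets gives the general case.
\<close>

section \<open>Convolutions of indicator functions and the Riesz form\<close>

lemma nn_integral_lborel_shift:
  fixes f :: "'a::euclidean_space \<Rightarrow> ennreal"
  assumes [measurable]: "f \<in> borel_measurable borel"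
  shows "(\<integral>\<^sup>+x. f (x + c) \<partial>lborel) = (\<integral>\<^sup>+x. f x \<partial>lborel)"
proof -
  have "(\<integral>\<^sup>+x. f x \<partial>lborel) = (\<integral>\<^sup>+x. f x \<partial>distr lborel borel ((+) c))"
    by (simp only: lborel_distr_plus)
  also have "\<dots> = (\<integral>\<^sup>+x. f (c + x) \<partial>lborel)"
    by (rule nn_integral_distr) auto
  finally show ?thesis by (simp add: add.commute)
qed

text \<open>
The convolution of two indicator functions, valued in \<^typ>\<open>ennreal\<close>, so that its
integrals make sense unconditionally and Tonelli applies to them.
\<close>
definition conv :: "'a::euclidean_space set \<Rightarrow> 'a set \<Rightarrow> 'a \<Rightarrow> ennreal" where
  "conv A B z = (\<integral>\<^sup>+y. indicator A (z - y) * indicator B y \<partial>lborel)"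

text \<open>
The trilinear form of the Riesz rearrangement inequality for three sets. Writing it over pairs
\<open>(x, y)\<close> with \<open>x + y \<in> C\<close> makes it linear in all three constraints,
so that it can be integrated line by line, unlike the truncated integral.
\<close>
definition riesz_form :: "'a::euclidean_space set \<Rightarrow> 'a set \<Rightarrow> 'a set \<Rightarrow> ennreal" where
  "riesz_form A B C =
    (\<integral>\<^sup>+x. \<integral>\<^sup>+y. indicator A x * indicator B y * indicator C (x + y) \<partial>lborel \<partial>lborel)"

lemma borel_measurable_conv[measurable]:
  assumes [measurable]: "A \<in> sets borel" "B \<in> sets borel"
  shows "conv A B \<in> borel_measurable borel"
  unfolding conv_def[abs_def] by measurable

lemma nn_integral_plane_shear:
  fixes f :: "'a::euclidean_space \<Rightarrow> 'a \<Rightarrow> ennreal"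
  assumes [measurable]: "case_prod f \<in> borel_measurable (borel \<Otimes>\<^sub>M borel)"
  shows "(\<integral>\<^sup>+x. \<integral>\<^sup>+y. f x y \<partial>lborel \<partial>lborel) = (\<integral>\<^sup>+z. \<integral>\<^sup>+y. f (z - y) y \<partial>lborel \<partial>lborel)"
proof -
  have "(\<integral>\<^sup>+x. \<integral>\<^sup>+y. f x y \<partial>lborel \<partial>lborel) = (\<integral>\<^sup>+y. \<integral>\<^sup>+x. f x y \<partial>lborel \<partial>lborel)"
    by (rule lborel_pair.Fubini'[symmetric]) measurable
  also have "\<dots> = (\<integral>\<^sup>+y. \<integral>\<^sup>+x. f (x - y) y \<partial>lborel \<partial>lborel)"
  proof (rule nn_integral_cong)
    fix y
    show "(\<integral>\<^sup>+x. f x y \<partial>lborel) = (\<integral>\<^sup>+x. f (x - y) y \<partial>lborel)"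
      using nn_integral_lborel_shift[of "\<lambda>x. f x y" "-y"] by simp
  qed
  also have "\<dots> = (\<integral>\<^sup>+z. \<integral>\<^sup>+y. f (z - y) y \<partial>lborel \<partial>lborel)"
    by (rule lborel_pair.Fubini') measurable
  finally show ?thesis .
qed

lemma riesz_form_eq_conv:
  assumes [measurable]: "A \<in> sets borel" "B \<in> sets borel" "C \<in> sets borel"
  shows "riesz_form A B C = (\<integral>\<^sup>+z. indicator C z * conv A B z \<partial>lborel)"
  unfolding riesz_form_def conv_def
  by (subst nn_integral_plane_shear, measurable)
     (auto simp: nn_integral_cmult[symmetric] intro!: nn_integral_cong simp: mult_ac)

lemma nn_integral_conv:
  assumes [measurable]: "A \<in> sets borel" "B \<in> sets borel"
  shows "(\<integral>\<^sup>+z. conv A B z \<partial>lborel) = emeasure lborel A * emeasure lborel B"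
proof -
  have "(\<integral>\<^sup>+z. conv A B z \<partial>lborel) = riesz_form A B UNIV"
    by (simp add: riesz_form_eq_conv)
  also have "\<dots> = emeasure lborel A * emeasure lborel B"
    unfolding riesz_form_def
    by (simp add: nn_integral_cmult nn_integral_multc)
  finally show ?thesis .
qed

lemma riesz_form_le_product:
  assumes [measurable]: "A \<in> sets borel" "B \<in> sets borel" "C \<in> sets borel"
  shows "riesz_form A B C \<le> emeasure lborel A * emeasure lborel B"
proof -
  have "riesz_form A B C \<le> (\<integral>\<^sup>+z. conv A B z \<partial>lborel)"
    by (subst riesz_form_eq_conv, measurable) (auto intro!: nn_integral_mono simp: indicator_def)
  then show ?thesis by (simp add: nn_integral_conv)
qed

section \<open>The rearrangement inequality on the line\<close>

lemma emeasure_lborel_reflect: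
  fixes A :: "'a::euclidean_space set"
  assumes [measurable]: "A \<in> sets borel"
  shows "emeasure lborel {y. z - y \<in> A} = emeasure lborel A"
proof -
  have eq: "lborel = density (distr lborel borel (\<lambda>x::'a. z + (-1) *\<^sub>R x)) (\<lambda>_. 1)"
    using lborel_affine[of "-1" z] by simp
  have "emeasure lborel A = (\<integral>\<^sup>+x. indicator A x \<partial>lborel)" by simp
  also have "\<dots> = (\<integral>\<^sup>+x. indicator A (z - x) \<partial>lborel)"
    by (subst eq) (simp add: nn_integral_density nn_integral_distr density_1 del: nn_integral_indicator)
  also have "\<dots> = (\<integral>\<^sup>+x. indicator {y. z - y \<in> A} x \<partial>lborel)"
    by (intro nn_integral_cong) (auto simp: indicator_def)
  also have "\<dots> = emeasure lborel {y. z - y \<in> A}" by (rule nn_integral_indicator) measurable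
  finally show ?thesis by simp
qed

text \<open>
A cut \<open>x0\<close> of \<open>A\<close> and a cut \<open>y0\<close> of \<open>B\<close> divide
\<open>A \<times> B\<close> into the rectangle \<open>x \<le> x0\<close>, \<open>y \<ge>
y0\<close> and an L-shaped rest. The fibre over \<open>z\<close> is the part of the rest on the
antidiagonal \<open>x + y = z\<close>, parametrized by \<open>y\<close>.
\<close>
definition fibre :: "real set \<Rightarrow> real set \<Rightarrow> real \<Rightarrow> real \<Rightarrow> real \<Rightarrow> real set" where
  "fibre A B x0 y0 z = {y \<in> B. z - y \<in> A \<and> (x0 < z - y \<or> y < y0)}"

lemma riesz_form_split:
  fixes A B C :: "real set"
  assumes [measurable]: "A \<in> sets borel" "B \<in> sets borel" "C \<in> sets borel"
  shows "riesz_form A B C = riesz_form (A \<inter> {..x0}) (B \<inter> {y0..}) C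
    + (\<integral>\<^sup>+z. indicator C z * emeasure lborel (fibre A B x0 y0 z) \<partial>lborel)"
proof -
  \<comment> \<open>the integrand on the L-shaped complement of the rectangle\<close>
  let ?r = "\<lambda>x y. (if x0 < x \<or> y < y0 then indicator A x * indicator B y * indicator C (x + y) else 0 :: ennreal)"
  have "riesz_form A B C = (\<integral>\<^sup>+x. \<integral>\<^sup>+y. indicator (A \<inter> {..x0}) x * indicator (B \<inter> {y0..}) y * indicator C (x + y)
      + ?r x y \<partial>lborel \<partial>lborel)"
    unfolding riesz_form_def by (intro nn_integral_cong) (auto simp: indicator_def)
  also have "\<dots> = riesz_form (A \<inter> {..x0}) (B \<inter> {y0..}) C + (\<integral>\<^sup>+x. \<integral>\<^sup>+y. ?r x y \<partial>lborel \<partial>lborel)"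
    unfolding riesz_form_def by (simp add: nn_integral_add)
  also have "(\<integral>\<^sup>+x. \<integral>\<^sup>+y. ?r x y \<partial>lborel \<partial>lborel) = (\<integral>\<^sup>+z. \<integral>\<^sup>+y. ?r (z - y) y \<partial>lborel \<partial>lborel)"
    by (rule nn_integral_plane_shear) measurable
  also have "\<dots> = (\<integral>\<^sup>+z. \<integral>\<^sup>+y. indicator C z * indicator (fibre A B x0 y0 z) y \<partial>lborel \<partial>lborel)"
    by (intro nn_integral_cong) (auto simp: fibre_def indicator_def)
  also have "\<dots> = (\<integral>\<^sup>+z. indicator C z * emeasure lborel (fibre A B x0 y0 z) \<partial>lborel)"
  proof (intro nn_integral_cong)
    fix z
    have [measurable]: "fibre A B x0 y0 z \<in> sets borel" unfolding fibre_def by measurable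
    show "(\<integral>\<^sup>+y. indicator C z * indicator (fibre A B x0 y0 z) y \<partial>lborel)
        = indicator C z * emeasure lborel (fibre A B x0 y0 z)"
      by (simp add: nn_integral_cmult)
  qed
  finally show ?thesis .
qed

text \<open>
The condition \<open>x0 < z - y \<or> y < y0\<close> says \<open>y < max (z - x0) y0\<close>.
Hence the whole fibre lies in one of the two arms of the L: its points all have \<open>y <
y0\<close>, or all have \<open>x > x0\<close>. This is the continuous form of covering part of a
grid by disjoint monotone paths, each of which meets an antidiagonal at most once.
\<close>
lemma emeasure_fibre_le:
  fixes A B :: "real set"
  assumes [measurable]: "A \<in> sets borel" "B \<in> sets borel"
  shows "emeasure lborel (fibre A B x0 y0 z)
    \<le> max (emeasure lborel (A \<inter> {x0<..})) (emeasure lborel (B \<inter> {..<y0}))"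
proof (cases "z - x0 \<le> y0")
  case True
  then have "fibre A B x0 y0 z \<subseteq> B \<inter> {..<y0}" by (auto simp: fibre_def)
  then have "emeasure lborel (fibre A B x0 y0 z) \<le> emeasure lborel (B \<inter> {..<y0})"
    by (intro emeasure_mono) auto
  then show ?thesis by (simp add: max.coboundedI2)
next
  case False
  then have "fibre A B x0 y0 z \<subseteq> {y. z - y \<in> A \<inter> {x0<..}}" by (auto simp: fibre_def)
  then have "emeasure lborel (fibre A B x0 y0 z) \<le> emeasure lborel {y. z - y \<in> A \<inter> {x0<..}}"
    by (intro emeasure_mono) measurable
  also have "\<dots> = emeasure lborel (A \<inter> {x0<..})"
    by (rule emeasure_lborel_reflect) measurable
  finally show ?thesis by (simp add: max.coboundedI1)
qed

text \<open>
The distribution function of \<open>A\<close> is 1-Lipschitz and tends to 0 and \<open>a\<close>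
at the two ends, so it attains every value in between.
\<close>
lemma exists_cut:
  fixes A :: "real set"
  assumes [measurable]: "A \<in> sets borel" and a: "emeasure lborel A = ennreal a"
    and t: "0 < t" "t < a"
  shows "\<exists>y. emeasure lborel (A \<inter> {..<y}) = ennreal t \<and> emeasure lborel (A \<inter> {y..}) = ennreal (a - t)"
proof -
  define h where "h y = measure lborel (A \<inter> {..<y})" for y
  have fin: "emeasure lborel (A \<inter> S) \<noteq> \<infinity>" if "S \<in> sets borel" for S
  proof -
    have "emeasure lborel (A \<inter> S) \<le> emeasure lborel A" using that by (intro emeasure_mono) auto
    then show ?thesis using a by (auto simp: top_unique)
  qed
  have ma: "measure lborel A = a" using a t by (simp add: measure_def)
  have diff: "\<bar>h y - h x\<bar> \<le> \<bar>y - x\<bar>" for x y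
  proof (induction x y rule: linorder_wlog)
    case (le x y)
    have "h y = h x + measure lborel (A \<inter> {x..<y})"
    proof -
      have "A \<inter> {..<y} = (A \<inter> {..<x}) \<union> (A \<inter> {x..<y})" using le by auto
      then show ?thesis unfolding h_def
        using fin by (simp only:, intro measure_Union) auto
    qed
    moreover have "measure lborel (A \<inter> {x..<y}) \<le> measure lborel {x..<y}"
      using le by (intro measure_mono_fmeasurable) (auto simp: fmeasurable_def)
    ultimately show ?case using le by simp
  next
    case (sym x y) then show ?case by (simp add: abs_minus_commute)
  qed
  have cont: "continuous_on S h" for S
    unfolding continuous_on_iff dist_real_def using diff by (metis le_less_trans)
  have up: "(\<lambda>n. h (real n)) \<longlonglongrightarrow> measure lborel (\<Union>n. A \<inter> {..<real n})"
    unfolding h_def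
  proof (rule Lim_measure_incseq)
    show "incseq (\<lambda>n. A \<inter> {..<real n})" by (auto simp: incseq_def)
    show "emeasure lborel (\<Union>n. A \<inter> {..<real n}) \<noteq> \<infinity>"
      using fin[of "\<Union>n. {..<real n}"] by simp
  qed auto
  have "(\<Union>n. A \<inter> {..<real n}) = A" using reals_Archimedean2 by auto
  with up ma have "eventually (\<lambda>n. h (real n) > t) sequentially"
    using t by (auto intro: order_tendstoD)
  then obtain n where n: "h (real n) > t" by (auto simp: eventually_sequentially)
  have dn: "(\<lambda>n. h (- real n)) \<longlonglongrightarrow> measure lborel (\<Inter>n. A \<inter> {..<- real n})"
    unfolding h_def
  proof (rule Lim_measure_decseq)
    show "decseq (\<lambda>n. A \<inter> {..<- real n})" by (auto simp: decseq_def)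
  qed (use fin in auto)
  have "(\<Inter>n. A \<inter> {..<- real n}) = {}"
  proof safe
    fix x assume x: "x \<in> (\<Inter>n. A \<inter> {..<- real n})"
    obtain n where "-x < real n" using reals_Archimedean2 by blast
    with x show "x \<in> {}" by (auto dest: spec[of _ n])
  qed
  with dn have "eventually (\<lambda>n. h (- real n) < t) sequentially"
    using t by (auto intro: order_tendstoD)
  then obtain m where m: "h (- real m) < t" by (auto simp: eventually_sequentially)
  have "\<exists>y\<ge>- real m. y \<le> real n \<and> h y = t"
    by (rule IVT') (use n m cont in auto)
  then obtain y where y: "h y = t" by blast
  have e: "emeasure lborel (A \<inter> {..<y}) = ennreal t"
    using y fin[of "{..<y}"] by (simp add: h_def emeasure_eq_ennreal_measure top_unique)
  have "emeasure lborel A = emeasure lborel (A \<inter> {..<y}) + emeasure lborel (A \<inter> {y..})"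
    by (subst plus_emeasure) (auto intro: arg_cong[where f = "emeasure lborel"])
  then have "ennreal a = ennreal t + emeasure lborel (A \<inter> {y..})" using a e by simp
  then have "emeasure lborel (A \<inter> {y..}) = ennreal a - ennreal t" by simp
  then show ?thesis using e t by (auto simp: ennreal_minus)
qed

lemma exists_cut_upper:
  fixes A :: "real set"
  assumes [measurable]: "A \<in> sets borel" and a: "emeasure lborel A = ennreal a"
    and t: "0 < t" "t < a"
  shows "\<exists>y. emeasure lborel (A \<inter> {y<..}) = ennreal t \<and> emeasure lborel (A \<inter> {..y}) = ennreal (a - t)"
proof -
  let ?A = "{y. 0 - y \<in> A}"
  have "emeasure lborel ?A = ennreal a" using a by (subst emeasure_lborel_reflect) auto
  then obtain y where y: "emeasure lborel (?A \<inter> {..<y}) = ennreal t"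
    "emeasure lborel (?A \<inter> {y..}) = ennreal (a - t)"
    using exists_cut[of ?A a t] t by auto
  have "?A \<inter> {..<y} = {x. 0 - x \<in> A \<inter> {-y<..}}" "?A \<inter> {y..} = {x. 0 - x \<in> A \<inter> {..-y}}" by auto
  with y show ?thesis
    by (intro exI[of _ "-y"]) (simp only: emeasure_lborel_reflect assms(1) sets.Int borel_closed
       closed_atMost borel_open open_greaterThan)
qed

text \<open>
Cut both sets so that each arm of the L has thickness \<open>t\<close>. The rectangle contributes
at most its area \<open>(a - t) (b - t)\<close>, and the rest at most \<open>t\<close> for each
\<open>z \<in> C\<close>.
\<close>
lemma riesz_form_le_cut:
  fixes A B C :: "real set"
  assumes [measurable]: "A \<in> sets borel" "B \<in> sets borel" "C \<in> sets borel"
    and a: "emeasure lborel A = ennreal a" and b: "emeasure lborel B = ennreal b"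
    and c: "emeasure lborel C = ennreal c" and nn: "0 \<le> c"
    and t: "0 < t" "t < a" "t < b"
  shows "riesz_form A B C \<le> ennreal ((a - t) * (b - t) + t * c)"
proof -
  obtain x0 where x0: "emeasure lborel (A \<inter> {x0<..}) = ennreal t"
      "emeasure lborel (A \<inter> {..x0}) = ennreal (a - t)"
    using exists_cut_upper[OF _ a] t by auto
  obtain y0 where y0: "emeasure lborel (B \<inter> {..<y0}) = ennreal t"
      "emeasure lborel (B \<inter> {y0..}) = ennreal (b - t)"
    using exists_cut[OF _ b] t by auto
  have "riesz_form (A \<inter> {..x0}) (B \<inter> {y0..}) C \<le> ennreal (a - t) * ennreal (b - t)"
    using riesz_form_le_product[of "A \<inter> {..x0}" "B \<inter> {y0..}" C] x0 y0 by simp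
  moreover have "(\<integral>\<^sup>+z. indicator C z * emeasure lborel (fibre A B x0 y0 z) \<partial>lborel)
      \<le> (\<integral>\<^sup>+z. indicator C z * ennreal t \<partial>lborel)"
    using emeasure_fibre_le[of A B x0 y0] x0 y0
    by (intro nn_integral_mono mult_left_mono) auto
  moreover have "(\<integral>\<^sup>+z. indicator C z * ennreal t \<partial>lborel) = ennreal c * ennreal t"
    using c by (simp add: nn_integral_multc)
  ultimately have "riesz_form A B C \<le> ennreal (a - t) * ennreal (b - t) + ennreal c * ennreal t"
    by (subst riesz_form_split[of A B C x0 y0]) (auto intro: add_mono)
  then show ?thesis using t nn by (simp add: ennreal_mult[symmetric] ennreal_plus[symmetric] mult.commute del: ennreal_plus)
qed

lemma riesz_form_swap:
  assumes [measurable]: "A \<in> sets borel" "B \<in> sets borel" "C \<in> sets borel"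
  shows "riesz_form A B C = riesz_form B A C"
proof -
  have "riesz_form A B C
      = (\<integral>\<^sup>+y. \<integral>\<^sup>+x. indicator A x * indicator B y * indicator C (x + y) \<partial>lborel \<partial>lborel)"
    unfolding riesz_form_def by (rule lborel_pair.Fubini'[symmetric]) measurable
  then show ?thesis unfolding riesz_form_def by (simp add: mult_ac add.commute)
qed

lemma riesz_form_le_right:
  fixes A B C :: "'a::euclidean_space set"
  assumes [measurable]: "A \<in> sets borel" "B \<in> sets borel" "C \<in> sets borel"
  shows "riesz_form A B C \<le> emeasure lborel B * emeasure lborel C"
proof -
  have "riesz_form A B C = (\<integral>\<^sup>+z. indicator C z * conv A B z \<partial>lborel)" by (simp add: riesz_form_eq_conv)
  also have "\<dots> \<le> (\<integral>\<^sup>+z. indicator C z * emeasure lborel B \<partial>lborel)"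
  proof (intro nn_integral_mono mult_left_mono)
    fix z
    have "conv A B z \<le> (\<integral>\<^sup>+y. indicator B y \<partial>lborel)" unfolding conv_def
      by (intro nn_integral_mono) (auto simp: indicator_def)
    then show "conv A B z \<le> emeasure lborel B" by simp
  qed auto
  finally show ?thesis by (simp add: nn_integral_multc mult.commute)
qed

abbreviation centred_interval :: "real \<Rightarrow> real \<Rightarrow> real set" where
  "centred_interval p l \<equiv> {p - l / 2 <..< p + l / 2}"

lemma riesz_form_eq_product:
  assumes [measurable]: "A \<in> sets borel" "B \<in> sets borel"
    and "\<And>x y. x \<in> A \<Longrightarrow> y \<in> B \<Longrightarrow> x + y \<in> C"
  shows "riesz_form A B C = emeasure lborel A * emeasure lborel B"
proof -
  have "riesz_form A B C = (\<integral>\<^sup>+x. \<integral>\<^sup>+y. indicator A x * indicator B y \<partial>lborel \<partial>lborel)"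
    unfolding riesz_form_def using assms(3) by (intro nn_integral_cong) (auto simp: indicator_def)
  then show ?thesis by (simp add: nn_integral_cmult nn_integral_multc)
qed

text \<open>
For intervals the two estimates behind the bound \<open>(a - t) (b - t) + t c\<close> are sharp
for the right \<open>t\<close>. If \<open>t \<ge> (a + b - c) / 2\<close>, all sums from the
rectangle fall into the third interval; if \<open>t \<le> (a + b - c) / 2\<close>, each fibre over
that interval has length at least \<open>t\<close>. The alternatives \<open>t = 0\<close>,
\<open>t = a\<close> and \<open>t = b\<close> are the cases where one of the two contributions
vanishes.
\<close>
lemma riesz_form_centred_intervals_ge:
  assumes nn: "0 \<le> c" and t: "0 \<le> t" "t \<le> a" "t \<le> b"
    and low: "t = 0 \<or> t \<le> (a + b - c) / 2"
    and high: "t = a \<or> t = b \<or> (a + b - c) / 2 \<le> t"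
  shows "ennreal ((a - t) * (b - t) + t * c)
    \<le> riesz_form (centred_interval p a) (centred_interval q b) (centred_interval (p + q) c)"
proof -
  let ?A = "centred_interval p a" and ?B = "centred_interval q b" and ?C = "centred_interval (p + q) c"
  define x0 where "x0 = p + a / 2 - t"
  define y0 where "y0 = q - b / 2 + t"
  have "ennreal ((a - t) * (b - t)) \<le> riesz_form (?A \<inter> {..x0}) (?B \<inter> {y0..}) ?C"
  proof (cases "t = a \<or> t = b")
    case False
    with high have h: "(a + b - c) / 2 \<le> t" by blast
    have "{p - a / 2 <..< x0} \<subseteq> ?A \<inter> {..x0}" "{y0 <..< q + b / 2} \<subseteq> ?B \<inter> {y0..}"
      using t by (auto simp: x0_def y0_def)
    then have "emeasure lborel {p - a / 2 <..< x0} * emeasure lborel {y0 <..< q + b / 2}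
        \<le> emeasure lborel (?A \<inter> {..x0}) * emeasure lborel (?B \<inter> {y0..})"
      by (intro mult_mono emeasure_mono) auto
    moreover have "emeasure lborel {p - a / 2 <..< x0} * emeasure lborel {y0 <..< q + b / 2}
        = ennreal ((a - t) * (b - t))"
      using t by (simp add: x0_def y0_def ennreal_mult)
    moreover have "riesz_form (?A \<inter> {..x0}) (?B \<inter> {y0..}) ?C
        = emeasure lborel (?A \<inter> {..x0}) * emeasure lborel (?B \<inter> {y0..})"
    proof (rule riesz_form_eq_product)
      fix x y assume "x \<in> ?A \<inter> {..x0}" "y \<in> ?B \<inter> {y0..}"
      then show "x + y \<in> ?C" using h by (auto simp: x0_def y0_def field_simps)
    qed auto
    ultimately show ?thesis by simp
  qed auto
  moreover have "ennreal (t * c)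
      \<le> (\<integral>\<^sup>+z. indicator ?C z * emeasure lborel (fibre ?A ?B x0 y0 z) \<partial>lborel)"
  proof (cases "t = 0")
    case False
    with low have l: "t \<le> (a + b - c) / 2" by blast
    have fib: "ennreal t \<le> emeasure lborel (fibre ?A ?B x0 y0 z)" if z: "z \<in> ?C" for z
    proof -
      have [measurable]: "fibre ?A ?B x0 y0 z \<in> sets borel" unfolding fibre_def by measurable
      show ?thesis
      proof (cases "z \<le> x0 + y0")
        case True
        have "{q - b / 2 <..< y0} \<subseteq> fibre ?A ?B x0 y0 z"
          using True l z t by (auto simp: x0_def y0_def fibre_def field_simps)
        then have "emeasure lborel {q - b / 2 <..< y0} \<le> emeasure lborel (fibre ?A ?B x0 y0 z)"
          by (intro emeasure_mono) auto
        then show ?thesis using t by (simp add: y0_def)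
      next
        case False
        have "{z - (p + a / 2) <..< z - x0} \<subseteq> fibre ?A ?B x0 y0 z"
          using False l z t by (auto simp: x0_def y0_def fibre_def field_simps)
        then have "emeasure lborel {z - (p + a / 2) <..< z - x0} \<le> emeasure lborel (fibre ?A ?B x0 y0 z)"
          by (intro emeasure_mono) auto
        then show ?thesis using t by (simp add: x0_def)
      qed
    qed
    have "ennreal (t * c) = (\<integral>\<^sup>+z. indicator ?C z * ennreal t \<partial>lborel)"
      using nn t by (subst nn_integral_multc) (auto simp: ennreal_mult mult.commute)
    also have "\<dots> \<le> (\<integral>\<^sup>+z. indicator ?C z * emeasure lborel (fibre ?A ?B x0 y0 z) \<partial>lborel)"
      using fib by (intro nn_integral_mono) (auto simp: indicator_def)
    finally show ?thesis .
  qed auto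
  ultimately have "ennreal ((a - t) * (b - t)) + ennreal (t * c) \<le> riesz_form ?A ?B ?C"
    by (subst riesz_form_split[of ?A ?B ?C x0 y0]) (auto intro: add_mono)
  then show ?thesis using t nn by simp
qed

text \<open>
The optimal thickness is \<open>(a + b - c) / 2\<close>, clamped to the range \<open>[0, min a
b]\<close>; at its ends the bound is one of the trivial ones by a product of two measures. The
intervals may have any centres that are compatible with \<open>x + y\<close>; this freedom is what
Steiner symmetrization needs, whose sections are not centred at the parameter 0.
\<close>
lemma riesz_sobolev_line:
  fixes A B C :: "real set"
  assumes [measurable]: "A \<in> sets borel" "B \<in> sets borel" "C \<in> sets borel"
    and a: "emeasure lborel A = ennreal a" "0 \<le> a"
    and b: "emeasure lborel B = ennreal b" "0 \<le> b"
    and c: "emeasure lborel C = ennreal c" "0 \<le> c"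
  shows "riesz_form A B C
    \<le> riesz_form (centred_interval p a) (centred_interval q b) (centred_interval (p + q) c)"
proof -
  define t where "t = max 0 (min (min a b) ((a + b - c) / 2))"
  have "riesz_form A B C \<le> ennreal ((a - t) * (b - t) + t * c)"
  proof -
    consider "t = 0" | "t = a" | "t = b" | "0 < t" "t < a" "t < b"
      using a b unfolding t_def by linarith
    then show ?thesis
    proof cases
      case 1 then show ?thesis using riesz_form_le_product[of A B C] a b by (simp add: ennreal_mult)
    next
      case 2 then show ?thesis using riesz_form_le_right[of B A C] riesz_form_swap[of A B C] a c
        by (simp add: ennreal_mult)
    next
      case 3 then show ?thesis using riesz_form_le_right[of A B C] b c by (simp add: ennreal_mult)
    next
      case 4 then show ?thesis using riesz_form_le_cut[of A B C a b c t] a b c by simp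
    qed
  qed
  also have "\<dots> \<le> riesz_form (centred_interval p a) (centred_interval q b) (centred_interval (p + q) c)"
    by (rule riesz_form_centred_intervals_ge) (use a b c in \<open>auto simp: t_def max_def min_def\<close>)
  finally show ?thesis .
qed

section \<open>Integration along parallel lines and Steiner symmetrization\<close>

text \<open>
Every line in the unit direction \<open>u\<close> spends exactly unit time in this slab. Using it
as a weight gives each line total weight one, which replaces integration over the orthogonal
complement of \<open>u\<close>.
\<close>
abbreviation slab :: "'a::euclidean_space \<Rightarrow> 'a \<Rightarrow> ennreal" where
  "slab u x \<equiv> indicator {0..<1::real} (x \<bullet> u)"

text \<open>
Integration over the space by lines in direction \<open>u\<close>. Translating by \<open>t
u\<close> moves the parameter \<open>t\<close> from \<open>f\<close> into the slab, and the slab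
integrates to 1 over \<open>t\<close>.
\<close>
lemma nn_integral_lines:
  fixes f :: "'a::euclidean_space \<Rightarrow> ennreal"
  assumes [measurable]: "f \<in> borel_measurable borel" and u: "norm u = 1"
  shows "(\<integral>\<^sup>+x. f x \<partial>lborel) = (\<integral>\<^sup>+x. slab u x * (\<integral>\<^sup>+t. f (x + t *\<^sub>R u) \<partial>lborel) \<partial>lborel)"
proof -
  have uu: "u \<bullet> u = 1" using u by (simp add: dot_square_norm)
  have "(\<integral>\<^sup>+x. slab u x * (\<integral>\<^sup>+t. f (x + t *\<^sub>R u) \<partial>lborel) \<partial>lborel)
      = (\<integral>\<^sup>+x. \<integral>\<^sup>+t. slab u x * f (x + t *\<^sub>R u) \<partial>lborel \<partial>lborel)"
    by (simp add: nn_integral_cmult)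
  also have "\<dots> = (\<integral>\<^sup>+t. \<integral>\<^sup>+x. slab u x * f (x + t *\<^sub>R u) \<partial>lborel \<partial>lborel)"
    by (rule lborel_pair.Fubini'[symmetric]) measurable
  also have "\<dots> = (\<integral>\<^sup>+t. \<integral>\<^sup>+x. indicator {0..<1} (x \<bullet> u - t) * f x \<partial>lborel \<partial>lborel)"
  proof (rule nn_integral_cong)
    fix t :: real
    show "(\<integral>\<^sup>+x. slab u x * f (x + t *\<^sub>R u) \<partial>lborel) = (\<integral>\<^sup>+x. indicator {0..<1} (x \<bullet> u - t) * f x \<partial>lborel)"
      using nn_integral_lborel_shift[of "\<lambda>x. indicator {0..<1} (x \<bullet> u - t) * f x" "t *\<^sub>R u"]
      by (simp add: inner_add_left uu)
  qed
  also have "\<dots> = (\<integral>\<^sup>+x. \<integral>\<^sup>+t. indicator {0..<1} (x \<bullet> u - t) * f x \<partial>lborel \<partial>lborel)"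
    by (rule lborel_pair.Fubini') measurable
  also have "\<dots> = (\<integral>\<^sup>+x. f x \<partial>lborel)"
  proof (rule nn_integral_cong)
    fix x :: 'a
    have "(\<integral>\<^sup>+t. indicator {0..<1} (x \<bullet> u - t) \<partial>lborel) = (\<integral>\<^sup>+t. indicator {x \<bullet> u - 1 <.. x \<bullet> u} t \<partial>lborel)"
      by (intro nn_integral_cong) (auto simp: indicator_def)
    also have "\<dots> = 1" by simp
    finally show "(\<integral>\<^sup>+t. indicator {0..<1} (x \<bullet> u - t) * f x \<partial>lborel) = f x"
      by (simp add: nn_integral_multc)
  qed
  finally show ?thesis by simp
qed

definition line_section :: "'a::euclidean_space set \<Rightarrow> 'a \<Rightarrow> 'a \<Rightarrow> real set" where
  "line_section A u x = {t. x + t *\<^sub>R u \<in> A}"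

definition chord :: "'a::euclidean_space set \<Rightarrow> 'a \<Rightarrow> 'a \<Rightarrow> ennreal" where
  "chord A u x = emeasure lborel (line_section A u x)"

text \<open>
On each line in direction \<open>u\<close>, the set \<open>A\<close> is replaced by an open
interval of the same length, centred at the foot of the perpendicular from the origin.
\<close>
definition steiner :: "'a::euclidean_space \<Rightarrow> 'a set \<Rightarrow> 'a set" where
  "steiner u A = {x. ennreal (2 * \<bar>x \<bullet> u\<bar>) < chord A u x}"

lemma sets_line_section[measurable]:
  assumes [measurable]: "A \<in> sets borel"
  shows "line_section A u x \<in> sets borel"
  unfolding line_section_def by measurable

lemma chord_eq_nn_integral:
  assumes [measurable]: "A \<in> sets borel"
  shows "chord A u x = (\<integral>\<^sup>+t. indicator A (x + t *\<^sub>R u) \<partial>lborel)"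
proof -
  have "chord A u x = (\<integral>\<^sup>+t. indicator (line_section A u x) t \<partial>lborel)"
    unfolding chord_def by (rule nn_integral_indicator[symmetric]) simp
  also have "\<dots> = (\<integral>\<^sup>+t. indicator A (x + t *\<^sub>R u) \<partial>lborel)"
    by (intro nn_integral_cong) (simp add: line_section_def indicator_def)
  finally show ?thesis .
qed

lemma borel_measurable_chord[measurable]:
  assumes [measurable]: "A \<in> sets borel"
  shows "chord A u \<in> borel_measurable borel"
proof -
  have "chord A u = (\<lambda>x. \<integral>\<^sup>+t. indicator A (x + t *\<^sub>R u) \<partial>lborel)"
    by (rule ext) (rule chord_eq_nn_integral, fact)
  then show ?thesis by simp
qed

lemma sets_steiner[measurable]:
  assumes [measurable]: "A \<in> sets borel"
  shows "steiner u A \<in> sets borel"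
  unfolding steiner_def by measurable

lemma emeasure_eq_chord:
  assumes [measurable]: "A \<in> sets borel" and "norm u = 1"
  shows "emeasure lborel A = (\<integral>\<^sup>+x. slab u x * chord A u x \<partial>lborel)"
proof -
  have "emeasure lborel A = (\<integral>\<^sup>+x. indicator A x \<partial>lborel)" by simp
  also have "\<dots> = (\<integral>\<^sup>+x. slab u x * (\<integral>\<^sup>+t. indicator A (x + t *\<^sub>R u) \<partial>lborel) \<partial>lborel)"
    by (rule nn_integral_lines) (use assms in auto)
  finally show ?thesis by (simp only: chord_eq_nn_integral[OF assms(1)])
qed

lemma chord_shift:
  assumes [measurable]: "A \<in> sets borel"
  shows "chord A u (x + s *\<^sub>R u) = chord A u x"
proof -
  have "chord A u (x + s *\<^sub>R u) = (\<integral>\<^sup>+t. indicator A (x + (t + s) *\<^sub>R u) \<partial>lborel)"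
    unfolding chord_eq_nn_integral[OF assms] by (simp add: scaleR_left_distrib add_ac)
  also have "\<dots> = chord A u x"
    unfolding chord_eq_nn_integral[OF assms] by (rule nn_integral_lborel_shift) measurable
  finally show ?thesis .
qed

lemma chord_mono:
  assumes [measurable]: "A \<in> sets borel" "B \<in> sets borel" and "A \<subseteq> B"
  shows "chord A u x \<le> chord B u x"
  unfolding chord_def using assms(3) by (intro emeasure_mono) (auto simp: line_section_def)

lemma chord_Un:
  assumes [measurable]: "A \<in> sets borel" "B \<in> sets borel" and "A \<inter> B = {}"
  shows "chord (A \<union> B) u x = chord A u x + chord B u x"
proof -
  have "line_section (A \<union> B) u x = line_section A u x \<union> line_section B u x"
    and "line_section A u x \<inter> line_section B u x = {}"
    using assms(3) by (auto simp: line_section_def)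
  then show ?thesis unfolding chord_def by (simp add: plus_emeasure)
qed

lemma chord_finite:
  assumes [measurable]: "A \<in> sets borel" and "bounded A" and u: "norm u = 1"
  obtains l where "chord A u x = ennreal l" "0 \<le> l"
proof -
  obtain R where R: "\<And>y. y \<in> A \<Longrightarrow> norm y \<le> R" using assms(2) unfolding bounded_iff by blast
  have uu: "u \<bullet> u = 1" using u by (simp add: dot_square_norm)
  have "line_section A u x \<subseteq> {- (x \<bullet> u) - R .. - (x \<bullet> u) + R}"
  proof
    fix t assume "t \<in> line_section A u x"
    then have "norm (x + t *\<^sub>R u) \<le> R" using R by (auto simp: line_section_def)
    then have "\<bar>(x + t *\<^sub>R u) \<bullet> u\<bar> \<le> R"
      using Cauchy_Schwarz_ineq2[of "x + t *\<^sub>R u" u] u by simp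
    then show "t \<in> {- (x \<bullet> u) - R .. - (x \<bullet> u) + R}" by (auto simp: inner_add_left uu)
  qed
  then have "chord A u x \<le> emeasure lborel {- (x \<bullet> u) - R .. - (x \<bullet> u) + R}"
    unfolding chord_def by (intro emeasure_mono) auto
  also have "\<dots> < \<infinity>" by (simp add: emeasure_lborel_Icc_eq)
  finally have "chord A u x \<noteq> \<infinity>" by simp
  then show ?thesis using that by (cases "chord A u x") auto
qed

lemma line_section_steiner:
  assumes [measurable]: "A \<in> sets borel" and u: "norm u = 1" and l: "chord A u x = ennreal l" "0 \<le> l"
  shows "line_section (steiner u A) u x = centred_interval (- (x \<bullet> u)) l"
proof -
  have uu: "u \<bullet> u = 1" using u by (simp add: dot_square_norm)
  have "t \<in> line_section (steiner u A) u x \<longleftrightarrow> 2 * \<bar>x \<bullet> u + t\<bar> < l" for t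
    by (simp add: line_section_def steiner_def chord_shift l inner_add_left uu ennreal_less_iff)
  moreover have "2 * \<bar>x \<bullet> u + t\<bar> < l \<longleftrightarrow> t \<in> centred_interval (- (x \<bullet> u)) l" for t
    unfolding greaterThanLessThan_iff by (simp add: abs_less_iff) argo
  ultimately show ?thesis by blast
qed

lemma chord_steiner:
  assumes [measurable]: "A \<in> sets borel" and b: "bounded A" and u: "norm u = 1"
  shows "chord (steiner u A) u x = chord A u x"
proof -
  obtain l where l: "chord A u x = ennreal l" "0 \<le> l" using chord_finite[OF assms] .
  then show ?thesis using line_section_steiner[OF assms(1) u l] unfolding chord_def[of "steiner u A"]
    by simp
qed

lemma emeasure_steiner:
  assumes [measurable]: "A \<in> sets borel" and b: "bounded A" and u: "norm u = 1"
  shows "emeasure lborel (steiner u A) = emeasure lborel A"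
  unfolding emeasure_eq_chord[OF sets_steiner[OF assms(1)] u] emeasure_eq_chord[OF assms(1) u]
    chord_steiner[OF assms] ..

text \<open>
Splitting both variables along \<open>u\<close> turns the Riesz form into an average of Riesz
forms of line sections.
\<close>
lemma riesz_form_lines:
  fixes A B C :: "'a::euclidean_space set"
  assumes [measurable]: "A \<in> sets borel" "B \<in> sets borel" "C \<in> sets borel" and u: "norm u = 1"
  shows "riesz_form A B C = (\<integral>\<^sup>+x. slab u x * (\<integral>\<^sup>+y. slab u y *
    riesz_form (line_section A u x) (line_section B u y) (line_section C u (x + y)) \<partial>lborel) \<partial>lborel)"
proof -
  let ?g = "\<lambda>x y. indicator A x * indicator B y * indicator C (x + y) :: ennreal"
  have "riesz_form A B C = (\<integral>\<^sup>+x. slab u x * (\<integral>\<^sup>+s. \<integral>\<^sup>+y. ?g (x + s *\<^sub>R u) y \<partial>lborel \<partial>lborel) \<partial>lborel)"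
    unfolding riesz_form_def by (rule nn_integral_lines[OF _ u]) measurable
  also have "\<dots> = (\<integral>\<^sup>+x. slab u x * (\<integral>\<^sup>+y. slab u y *
    riesz_form (line_section A u x) (line_section B u y) (line_section C u (x + y)) \<partial>lborel) \<partial>lborel)"
  proof (intro nn_integral_cong arg_cong[where f = "(*) (slab u _)"])
    fix x :: 'a
    have "(\<integral>\<^sup>+s. \<integral>\<^sup>+y. ?g (x + s *\<^sub>R u) y \<partial>lborel \<partial>lborel)
       = (\<integral>\<^sup>+s. \<integral>\<^sup>+y. slab u y * (\<integral>\<^sup>+t. ?g (x + s *\<^sub>R u) (y + t *\<^sub>R u) \<partial>lborel) \<partial>lborel \<partial>lborel)"
      by (intro nn_integral_cong nn_integral_lines[OF _ u]) measurable
    also have "\<dots> = (\<integral>\<^sup>+y. \<integral>\<^sup>+s. slab u y * (\<integral>\<^sup>+t. ?g (x + s *\<^sub>R u) (y + t *\<^sub>R u) \<partial>lborel) \<partial>lborel \<partial>lborel)"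
      by (rule lborel_pair.Fubini') measurable
    also have "\<dots> = (\<integral>\<^sup>+y. slab u y * (\<integral>\<^sup>+s. \<integral>\<^sup>+t. ?g (x + s *\<^sub>R u) (y + t *\<^sub>R u) \<partial>lborel \<partial>lborel) \<partial>lborel)"
      by (intro nn_integral_cong nn_integral_cmult) measurable
    also have "\<dots> = (\<integral>\<^sup>+y. slab u y *
        riesz_form (line_section A u x) (line_section B u y) (line_section C u (x + y)) \<partial>lborel)"
      unfolding riesz_form_def line_section_def
      by (intro nn_integral_cong arg_cong[where f = "(*) (slab u _)"])
        (simp add: indicator_def scaleR_left_distrib add_ac)
    finally show "(\<integral>\<^sup>+s. \<integral>\<^sup>+y. ?g (x + s *\<^sub>R u) y \<partial>lborel \<partial>lborel) = \<dots>" .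
  qed
  finally show ?thesis .
qed

lemma riesz_form_le_steiner:
  fixes A B C :: "'a::euclidean_space set"
  assumes [measurable]: "A \<in> sets borel" "B \<in> sets borel" "C \<in> sets borel" and u: "norm u = 1"
    and bd: "bounded A" "bounded B" "bounded C"
  shows "riesz_form A B C \<le> riesz_form (steiner u A) (steiner u B) (steiner u C)"
proof -
  have "riesz_form (line_section A u x) (line_section B u y) (line_section C u (x + y))
     \<le> riesz_form (line_section (steiner u A) u x) (line_section (steiner u B) u y)
        (line_section (steiner u C) u (x + y))" for x y
  proof -
    obtain a where a: "chord A u x = ennreal a" "0 \<le> a" using chord_finite[OF assms(1) assms(5) u] .
    obtain b where b: "chord B u y = ennreal b" "0 \<le> b" using chord_finite[OF assms(2) assms(6) u] .
    obtain c where c: "chord C u (x + y) = ennreal c" "0 \<le> c" using chord_finite[OF assms(3) assms(7) u] .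
    have "riesz_form (line_section A u x) (line_section B u y) (line_section C u (x + y))
      \<le> riesz_form (centred_interval (- (x \<bullet> u)) a) (centred_interval (- (y \<bullet> u)) b)
        (centred_interval (- (x \<bullet> u) + - (y \<bullet> u)) c)"
      by (rule riesz_sobolev_line) (use a b c in \<open>auto simp: chord_def\<close>)
    also have "- (x \<bullet> u) + - (y \<bullet> u) = - ((x + y) \<bullet> u)" by (simp add: inner_add_left)
    finally show ?thesis
      using a b c by (simp only: line_section_steiner[OF assms(1) u] line_section_steiner[OF assms(2) u]
          line_section_steiner[OF assms(3) u])
  qed
  then show ?thesis
    unfolding riesz_form_lines[OF assms(1-3) u]
      riesz_form_lines[OF sets_steiner[OF assms(1)] sets_steiner[OF assms(2)] sets_steiner[OF assms(3)] u]
    by (intro nn_integral_mono mult_left_mono) auto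
qed

section \<open>Steiner symmetrization approaches the ball\<close>

text \<open>
A point \<open>x\<close> outside the ball lies at distance \<open>\<bar>x \<bullet>
u\<bar>\<close> from the centre of its line. All points of the ball on that line are closer to the
centre, so the section of \<open>A\<close> has length at most \<open>2 \<bar>x \<bullet>
u\<bar>\<close>.
\<close>
lemma steiner_subset_cball:
  fixes A :: "'a::euclidean_space set"
  assumes [measurable]: "A \<in> sets borel" and sub: "A \<subseteq> cball 0 R" and u: "norm u = 1"
  shows "steiner u A \<subseteq> cball 0 R"
proof (rule ccontr)
  assume "\<not> steiner u A \<subseteq> cball 0 R"
  then obtain x where x: "x \<in> steiner u A" "R < norm x" by force
  let ?h = "2 * \<bar>x \<bullet> u\<bar>" and ?m = "- (x \<bullet> u)"
  have uu: "u \<bullet> u = 1" using u by (simp add: dot_square_norm)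
  have "line_section A u x \<subseteq> {?m - \<bar>x \<bullet> u\<bar> .. ?m + \<bar>x \<bullet> u\<bar>}"
  proof
    fix t assume "t \<in> line_section A u x"
    then have "norm (x + t *\<^sub>R u) \<le> R" using sub by (auto simp: line_section_def)
    then have "norm (x + t *\<^sub>R u) \<le> norm x" using x by simp
    then have "(x + t *\<^sub>R u) \<bullet> (x + t *\<^sub>R u) \<le> x \<bullet> x" by (simp add: norm_le)
    then have "(t + x \<bullet> u)\<^sup>2 \<le> (x \<bullet> u)\<^sup>2"
      by (simp add: inner_add_left inner_add_right uu inner_commute power2_eq_square algebra_simps)
    then have "\<bar>t + x \<bullet> u\<bar> \<le> \<bar>x \<bullet> u\<bar>" by (simp add: abs_le_square_iff)
    then show "t \<in> {?m - \<bar>x \<bullet> u\<bar> .. ?m + \<bar>x \<bullet> u\<bar>}" by (simp add: abs_le_iff)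
  qed
  then have "chord A u x \<le> emeasure lborel {?m - \<bar>x \<bullet> u\<bar> .. ?m + \<bar>x \<bullet> u\<bar>}"
    unfolding chord_def by (intro emeasure_mono) auto
  also have "\<dots> = ennreal ?h" by simp
  finally show False using x(1) by (simp add: steiner_def)
qed

text \<open>
On each line, the sections of the symmetrized set and of \<open>K\<close> are intervals with a
common centre, hence nested. So the part of the section outside \<open>K\<close> shrinks from
\<open>p = |A - K|\<close> to \<open>max 0 (p - q)\<close> with \<open>q = |K - A|\<close>, a gain
of \<open>min p q\<close>. If translation along the line matches part of \<open>A - K\<close> with
part of \<open>K - A\<close>, the measure of that part is a lower bound for the gain.
\<close>
lemma steiner_deficit:
  fixes A :: "'a::euclidean_space set" and \<rho> :: real
  assumes [measurable]: "A \<in> sets borel" and bd: "bounded A" and u: "norm u = 1"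
  defines "K \<equiv> cball 0 \<rho>"
  shows "emeasure lborel (steiner u A - K) + emeasure lborel {x \<in> A - K. x + s *\<^sub>R u \<in> K - A}
    \<le> emeasure lborel (A - K)"
proof -
  let ?D = "{x \<in> A - K. x + s *\<^sub>R u \<in> K - A}"
  have [measurable]: "K \<in> sets borel" by (simp add: K_def)
  have Dm[measurable]: "?D \<in> sets borel" by measurable
  have bK: "bounded K" by (simp add: K_def)
  have uu: "u \<bullet> u = 1" using u by (simp add: dot_square_norm)
  have "chord (steiner u A - K) u x + chord ?D u x \<le> chord (A - K) u x" for x
  proof -
    obtain l where l: "chord A u x = ennreal l" "0 \<le> l" using chord_finite[OF assms(1) bd u] .
    let ?I = "line_section (steiner u A) u x" and ?J = "line_section K u x"
    have dP: "chord ?D u x \<le> chord (A - K) u x" by (intro chord_mono) auto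
    have "chord ?D u x \<le> chord (K - A) u (x + s *\<^sub>R u)"
      unfolding chord_def
      by (intro emeasure_mono) (auto simp: line_section_def algebra_simps)
    then have dQ: "chord ?D u x \<le> chord (K - A) u x" by (simp add: chord_shift)
    have I: "?I = centred_interval (- (x \<bullet> u)) l"
      by (rule line_section_steiner[OF assms(1) u l])
    have diff: "line_section (steiner u A - K) u x = ?I - ?J" by (auto simp: line_section_def)
    \<comment> \<open>membership in the ball depends only on the distance to the foot of the perpendicular\<close>
    have Jmem: "t \<in> ?J" if "t' \<in> ?J" "\<bar>t + x \<bullet> u\<bar> \<le> \<bar>t' + x \<bullet> u\<bar>" for t t'
    proof -
      have sq: "(norm (x + r *\<^sub>R u))\<^sup>2 = x \<bullet> x - (x \<bullet> u)\<^sup>2 + (r + x \<bullet> u)\<^sup>2" for r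
        unfolding power2_norm_eq_inner
        by (simp add: inner_add_left inner_add_right uu inner_commute power2_eq_square algebra_simps)
      have "(norm (x + t *\<^sub>R u))\<^sup>2 \<le> (norm (x + t' *\<^sub>R u))\<^sup>2"
        using that(2) unfolding sq by (simp add: abs_le_square_iff)
      then have "norm (x + t *\<^sub>R u) \<le> norm (x + t' *\<^sub>R u)" by (simp add: power2_le_iff_abs_le)
      with that(1) show ?thesis by (simp add: line_section_def K_def)
    qed
    show ?thesis
    proof (cases "?I \<subseteq> ?J")
      case True
      then have "chord (steiner u A - K) u x = 0" unfolding chord_def diff by (simp add: Diff_eq_empty_iff[THEN iffD2])
      then show ?thesis using dP by simp
    next
      case False
      then obtain t where t: "t \<in> ?I" "t \<notin> ?J" by blast
      have JI: "?J \<subseteq> ?I"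
      proof
        fix t' assume t': "t' \<in> ?J"
        have "\<bar>t' + x \<bullet> u\<bar> < \<bar>t + x \<bullet> u\<bar>" using Jmem[OF t', of t] t(2) by fastforce
        then show "t' \<in> ?I" using t(1) unfolding I greaterThanLessThan_iff by linarith
      qed
      have "?I = (?I - ?J) \<union> ?J" using JI by blast
      then have "emeasure lborel ?I = emeasure lborel (?I - ?J) + emeasure lborel ?J"
        by (subst plus_emeasure) auto
      then have 1: "chord A u x = chord (steiner u A - K) u x + chord K u x"
        using chord_steiner[OF assms(1) bd u, of x] unfolding chord_def diff by simp
      have "chord A u x = chord ((A - K) \<union> (A \<inter> K)) u x" "chord K u x = chord ((K - A) \<union> (A \<inter> K)) u x"
        by (auto intro!: arg_cong[where f = "\<lambda>S. chord S u x"])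
      then have 2: "chord A u x = chord (A - K) u x + chord (A \<inter> K) u x"
        and 3: "chord K u x = chord (K - A) u x + chord (A \<inter> K) u x"
        by (subst (asm) (2) chord_Un; auto)+
      have "chord (A \<inter> K) u x \<le> chord A u x" by (intro chord_mono) auto
      then have fin: "chord (A \<inter> K) u x \<noteq> \<infinity>" using l by (auto simp: top_unique)
      have "chord (A \<inter> K) u x + (chord (steiner u A - K) u x + chord (K - A) u x)
          = chord (A \<inter> K) u x + chord (A - K) u x"
        using 1 2 3 by (metis add.assoc add.commute)
      then have "chord (steiner u A - K) u x + chord (K - A) u x = chord (A - K) u x"
        using fin by (simp only: ennreal_add_left_cancel simp_thms)
      moreover have "chord (steiner u A - K) u x + chord ?D u x
          \<le> chord (steiner u A - K) u x + chord (K - A) u x"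
        using dQ by (rule add_left_mono)
      ultimately show ?thesis by simp
    qed
  qed
  then have "(\<integral>\<^sup>+x. slab u x * (chord (steiner u A - K) u x + chord ?D u x) \<partial>lborel)
      \<le> (\<integral>\<^sup>+x. slab u x * chord (A - K) u x \<partial>lborel)"
    by (intro nn_integral_mono mult_left_mono) auto
  moreover have "(\<integral>\<^sup>+x. slab u x * (chord (steiner u A - K) u x + chord ?D u x) \<partial>lborel)
      = (\<integral>\<^sup>+x. slab u x * chord (steiner u A - K) u x \<partial>lborel) + (\<integral>\<^sup>+x. slab u x * chord ?D u x \<partial>lborel)"
    unfolding distrib_left by (rule nn_integral_add) measurable
  moreover have "emeasure lborel (steiner u A - K) = (\<integral>\<^sup>+x. slab u x * chord (steiner u A - K) u x \<partial>lborel)"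
    by (rule emeasure_eq_chord[OF _ u]) measurable
  moreover have "emeasure lborel ?D = (\<integral>\<^sup>+x. slab u x * chord ?D u x \<partial>lborel)"
    by (rule emeasure_eq_chord[OF Dm u])
  moreover have "emeasure lborel (A - K) = (\<integral>\<^sup>+x. slab u x * chord (A - K) u x \<partial>lborel)"
    by (rule emeasure_eq_chord[OF _ u]) measurable
  ultimately show ?thesis by simp
qed

lemma emeasure_bounded_neq_top: "bounded A \<Longrightarrow> emeasure lborel A \<noteq> \<infinity>"
  using emeasure_bounded_finite by fastforce

lemma emeasure_bounded_eq_measure:
  "bounded A \<Longrightarrow> emeasure lborel A = ennreal (measure lborel A)"
  using emeasure_bounded_neq_top[of A] by (simp add: emeasure_eq_ennreal_measure)

lemma measure_Diff_commute_bounded: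
  fixes S T :: "'a::euclidean_space set"
  assumes [measurable]: "S \<in> sets borel" "T \<in> sets borel" and bd: "bounded S" "bounded T"
    and eq: "emeasure lborel S = emeasure lborel T"
  shows "measure lborel (T - S) = measure lborel (S - T)"
proof -
  have split: "measure lborel X = measure lborel (X - Y) + measure lborel (X \<inter> Y)"
    if [measurable]: "X \<in> sets borel" "Y \<in> sets borel" and "bounded X" for X Y :: "'a set"
  proof -
    have "emeasure lborel (X - Y) \<noteq> \<infinity>" "emeasure lborel (X \<inter> Y) \<noteq> \<infinity>"
      by (rule emeasure_bounded_neq_top, simp add: that bounded_diff bounded_Int)+
    then have "measure lborel ((X - Y) \<union> (X \<inter> Y)) = measure lborel (X - Y) + measure lborel (X \<inter> Y)"
      by (intro measure_Union) auto
    then show ?thesis by (simp add: Un_Diff_Int)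
  qed
  have "measure lborel S = measure lborel T" using eq by (simp add: measure_def)
  then show ?thesis
    using split[OF assms(1,2) bd(1)] split[OF assms(2,1) bd(2)] by (simp add: Int_commute)
qed

text \<open>
The overlap of \<open>P\<close> with the translate of \<open>Q\<close> by \<open>- z\<close>
integrates to \<open>|P| |Q|\<close> over \<open>z\<close> and vanishes for \<open>|z| > 2
R\<close>, so some \<open>z\<close> reaches at least half the average over that ball. The factor 2
gives up the exact average so that a strict inequality survives integration.
\<close>
lemma exists_translate_overlap:
  fixes P Q :: "'a::euclidean_space set"
  assumes [measurable]: "P \<in> sets borel" "Q \<in> sets borel"
    and P: "P \<subseteq> cball 0 R" and Q: "Q \<subseteq> cball 0 R" and R: "0 < R"
  shows "\<exists>z. measure lborel P * measure lborel Q
    \<le> 2 * measure lborel (cball (0::'a) (2 * R)) * measure lborel {x \<in> P. x + z \<in> Q}"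
proof (rule ccontr)
  let ?V = "measure lborel (cball (0::'a) (2 * R))" and ?D = "\<lambda>z. {x \<in> P. x + z \<in> Q}"
  let ?m = "measure lborel P * measure lborel Q"
  assume "\<not> ?thesis"
  then have less: "2 * ?V * measure lborel (?D z) < ?m" for z by (auto simp: not_le)
  have V: "0 < ?V" using R by (simp add: content_cball_pos)
  have fin: "emeasure lborel S = ennreal (measure lborel S)" if "S \<subseteq> cball 0 R" for S :: "'a set"
    by (rule emeasure_bounded_eq_measure[OF bounded_subset[OF bounded_cball that]])
  have DP: "?D z \<subseteq> cball 0 R" for z using P by auto
  have "0 \<le> 2 * ?V * measure lborel (?D 0)" by simp
  also have "\<dots> < ?m" by (rule less)
  finally have m: "0 < ?m" .
  have "ennreal ?m = emeasure lborel P * emeasure lborel Q"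
    by (simp add: fin P Q ennreal_mult)
  also have "\<dots> = (\<integral>\<^sup>+x. \<integral>\<^sup>+z. indicator P x * indicator Q z \<partial>lborel \<partial>lborel)"
    by (simp add: nn_integral_cmult nn_integral_multc)
  also have "\<dots> = (\<integral>\<^sup>+x. \<integral>\<^sup>+z. indicator P x * indicator Q (z + x) \<partial>lborel \<partial>lborel)"
    by (intro nn_integral_cong nn_integral_lborel_shift[symmetric]) measurable
  also have "\<dots> = (\<integral>\<^sup>+z. \<integral>\<^sup>+x. indicator P x * indicator Q (z + x) \<partial>lborel \<partial>lborel)"
    by (rule lborel_pair.Fubini') measurable
  also have "\<dots> = (\<integral>\<^sup>+z. emeasure lborel (?D z) \<partial>lborel)"
  proof (rule nn_integral_cong)
    fix z
    have [measurable]: "?D z \<in> sets borel" by measurable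
    have "(\<integral>\<^sup>+x. indicator P x * indicator Q (z + x) \<partial>lborel) = (\<integral>\<^sup>+x. indicator (?D z) x \<partial>lborel)"
      by (intro nn_integral_cong) (auto simp: indicator_def add.commute)
    also have "\<dots> = emeasure lborel (?D z)" by (rule nn_integral_indicator) simp
    finally show "(\<integral>\<^sup>+x. indicator P x * indicator Q (z + x) \<partial>lborel) = emeasure lborel (?D z)" .
  qed
  also have "\<dots> \<le> (\<integral>\<^sup>+z. ennreal (?m / (2 * ?V)) * indicator (cball (0::'a) (2 * R)) z \<partial>lborel)"
  proof (rule nn_integral_mono)
    fix z
    show "emeasure lborel (?D z) \<le> ennreal (?m / (2 * ?V)) * indicator (cball (0::'a) (2 * R)) z"
    proof (cases "z \<in> cball 0 (2 * R)")
      case True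
      have "measure lborel (?D z) \<le> ?m / (2 * ?V)"
        using less[of z] V by (simp add: field_simps)
      then show ?thesis using True by (simp add: fin[OF DP] ennreal_leI)
    next
      case False
      have "?D z = {}"
      proof safe
        fix x assume "x \<in> P" "x + z \<in> Q"
        then have "norm x \<le> R" "norm (x + z) \<le> R" using P Q by auto
        moreover have "norm z \<le> norm (x + z) + norm x" by (metis add_diff_cancel_left' norm_triangle_ineq4)
        ultimately show "x \<in> {}" using False by simp
      qed
      then show ?thesis by (simp only: emeasure_empty zero_le)
    qed
  qed
  also have "\<dots> = ennreal (?m / (2 * ?V)) * emeasure lborel (cball (0::'a) (2 * R))"
    by (rule nn_integral_cmult_indicator) simp
  also have "emeasure lborel (cball (0::'a) (2 * R)) = ennreal ?V"
    by (simp add: emeasure_bounded_eq_measure)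
  also have "ennreal (?m / (2 * ?V)) * ennreal ?V = ennreal (?m / 2)"
    using V m by (simp add: ennreal_mult[symmetric] field_simps)
  finally show False using m by simp
qed

section \<open>Truncated integrals and the Riesz form\<close>

definition truncated_integral :: "ennreal \<Rightarrow> 'a::euclidean_space set \<Rightarrow> 'a set \<Rightarrow> ennreal" where
  "truncated_integral \<tau> A B = (\<integral>\<^sup>+z. min (conv A B z) \<tau> \<partial>lborel)"

text \<open>
Together with the equality for superlevel sets, this is the duality between truncation and the
Riesz form: the truncated integral is \<open>|A| |B|\<close> minus the maximum over
\<open>C\<close> of the Riesz form diminished by \<open>\<tau> |C|\<close>. It is stated
additively because subtraction on \<^typ>\<open>ennreal\<close> truncates at 0.
\<close>
lemma truncated_integral_riesz_form_le:
  assumes [measurable]: "A \<in> sets borel" "B \<in> sets borel" "C \<in> sets borel"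
  shows "truncated_integral \<tau> A B + riesz_form A B C \<le> emeasure lborel A * emeasure lborel B + \<tau> * emeasure lborel C"
proof -
  have "truncated_integral \<tau> A B + riesz_form A B C = (\<integral>\<^sup>+z. min (conv A B z) \<tau> + indicator C z * conv A B z \<partial>lborel)"
    unfolding truncated_integral_def riesz_form_eq_conv[OF assms] by (rule nn_integral_add[symmetric]) measurable
  also have "\<dots> \<le> (\<integral>\<^sup>+z. conv A B z + \<tau> * indicator C z \<partial>lborel)"
    by (intro nn_integral_mono) (auto simp: indicator_def add.commute intro: add_mono)
  also have "\<dots> = (\<integral>\<^sup>+z. conv A B z \<partial>lborel) + \<tau> * emeasure lborel C"
    by (simp add: nn_integral_add nn_integral_cmult_indicator)
  finally show ?thesis by (simp add: nn_integral_conv)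
qed

lemma truncated_integral_riesz_form_superlevel:
  fixes A B :: "'a::euclidean_space set" and \<tau> :: ennreal
  assumes [measurable]: "A \<in> sets borel" "B \<in> sets borel"
  defines "C \<equiv> {z. \<tau> < conv A B z}"
  shows "truncated_integral \<tau> A B + riesz_form A B C = emeasure lborel A * emeasure lborel B + \<tau> * emeasure lborel C"
proof -
  have [measurable]: "C \<in> sets borel" unfolding C_def by measurable
  have "truncated_integral \<tau> A B + riesz_form A B C = (\<integral>\<^sup>+z. min (conv A B z) \<tau> + indicator C z * conv A B z \<partial>lborel)"
    unfolding truncated_integral_def riesz_form_eq_conv[OF assms(1,2) \<open>C \<in> _\<close>]
    by (rule nn_integral_add[symmetric]) measurable
  also have "\<dots> = (\<integral>\<^sup>+z. conv A B z + \<tau> * indicator C z \<partial>lborel)"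
    by (intro nn_integral_cong) (auto simp: indicator_def C_def add.commute min_def)
  also have "\<dots> = (\<integral>\<^sup>+z. conv A B z \<partial>lborel) + \<tau> * emeasure lborel C"
    by (simp add: nn_integral_add nn_integral_cmult_indicator)
  finally show ?thesis by (simp add: nn_integral_conv)
qed

lemma bounded_superlevel_conv:
  fixes A B :: "'a::euclidean_space set"
  assumes "bounded A" "bounded B"
  shows "bounded {z. \<tau> < conv A B z}"
proof -
  obtain a where a: "\<And>x. x \<in> A \<Longrightarrow> norm x \<le> a" using assms(1) unfolding bounded_iff by blast
  obtain b where b: "\<And>x. x \<in> B \<Longrightarrow> norm x \<le> b" using assms(2) unfolding bounded_iff by blast
  have "norm z \<le> a + b" if "\<tau> < conv A B z" for z
  proof -
    have "\<exists>y. y \<in> B \<and> z - y \<in> A"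
    proof (rule ccontr)
      assume none: "\<not> ?thesis"
      have "conv A B z = (\<integral>\<^sup>+(y::'a). 0 \<partial>lborel)"
        unfolding conv_def by (intro nn_integral_cong) (use none in \<open>auto simp: indicator_def\<close>)
      with that show False by simp
    qed
    then obtain y where "y \<in> B" "z - y \<in> A" by blast
    then have "norm y \<le> b" "norm (z - y) \<le> a" using a b by auto
    then show ?thesis using norm_triangle_ineq[of "z - y" y] by simp
  qed
  then show ?thesis unfolding bounded_iff by blast
qed

text \<open>
Take the optimal \<open>C\<close> for \<open>A\<close> and \<open>B\<close>. Symmetrizing all
three sets preserves the measures and raises the Riesz form, and the symmetrized \<open>C\<close>
is one of the competitors in the duality for the symmetrized pair.
\<close>
lemma truncated_integral_steiner_le:
  fixes A B :: "'a::euclidean_space set"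
  assumes [measurable]: "A \<in> sets borel" "B \<in> sets borel" and bd: "bounded A" "bounded B"
    and u: "norm u = 1"
  shows "truncated_integral \<tau> (steiner u A) (steiner u B) \<le> truncated_integral \<tau> A B"
proof -
  define C where "C = {z. \<tau> < conv A B z}"
  have [measurable]: "C \<in> sets borel" unfolding C_def by measurable
  have bC: "bounded C" unfolding C_def using bd by (rule bounded_superlevel_conv)
  let ?T = "riesz_form (steiner u A) (steiner u B) (steiner u C)"
  have T: "?T \<le> emeasure lborel A * emeasure lborel B"
    using riesz_form_le_product[of "steiner u A" "steiner u B" "steiner u C"]
    by (simp add: emeasure_steiner bd u)
  have "emeasure lborel A * emeasure lborel B \<noteq> \<infinity>"
    using bd[THEN emeasure_bounded_neq_top] by (simp add: ennreal_mult_eq_top_iff)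
  with T have fin: "?T \<noteq> \<infinity>" by (auto simp: top_unique)
  have "truncated_integral \<tau> (steiner u A) (steiner u B) + ?T
      \<le> emeasure lborel A * emeasure lborel B + \<tau> * emeasure lborel C"
    using truncated_integral_riesz_form_le[of "steiner u A" "steiner u B" "steiner u C" \<tau>]
    by (simp add: emeasure_steiner bd u bC)
  also have "\<dots> = truncated_integral \<tau> A B + riesz_form A B C"
    unfolding C_def by (rule truncated_integral_riesz_form_superlevel[symmetric]) auto
  also have "\<dots> \<le> truncated_integral \<tau> A B + ?T"
    by (intro add_left_mono riesz_form_le_steiner) (auto simp: bd u bC)
  finally show ?thesis using fin by (simp add: add.commute ennreal_add_left_cancel_le)
qed

text \<open>
Continuity in measure, from \<open>1_K * 1_L \<le> 1_A * 1_B + 1_(K - A) * 1_L + 1_A * 1_(L -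
B)\<close>.
\<close>
lemma truncated_integral_perturb:
  assumes [measurable]: "A \<in> sets borel" "B \<in> sets borel" "K \<in> sets borel" "L \<in> sets borel"
  shows "truncated_integral \<tau> K L \<le> truncated_integral \<tau> A B
    + (emeasure lborel (K - A) * emeasure lborel L + emeasure lborel A * emeasure lborel (L - B))"
proof -
  have c: "conv K L z \<le> conv A B z + (conv (K - A) L z + conv A (L - B) z)" for z
  proof -
    have "conv K L z \<le> (\<integral>\<^sup>+y. indicator A (z - y) * indicator B y
        + (indicator (K - A) (z - y) * indicator L y + indicator A (z - y) * indicator (L - B) y) \<partial>lborel)"
      unfolding conv_def by (intro nn_integral_mono) (auto simp: indicator_def)
    also have "\<dots> = conv A B z + (conv (K - A) L z + conv A (L - B) z)"
      unfolding conv_def by (simp add: nn_integral_add)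
    finally show ?thesis .
  qed
  have "truncated_integral \<tau> K L \<le> (\<integral>\<^sup>+z. min (conv A B z) \<tau> + (conv (K - A) L z + conv A (L - B) z) \<partial>lborel)"
    unfolding truncated_integral_def
  proof (rule nn_integral_mono)
    fix z
    show "min (conv K L z) \<tau> \<le> min (conv A B z) \<tau> + (conv (K - A) L z + conv A (L - B) z)"
      using c[of z] by (auto simp: min_def intro: add_increasing2)
  qed
  also have "\<dots> = truncated_integral \<tau> A B + (emeasure lborel (K - A) * emeasure lborel L
      + emeasure lborel A * emeasure lborel (L - B))"
    unfolding truncated_integral_def by (simp add: nn_integral_add nn_integral_conv)
  finally show ?thesis .
qed

section \<open>From Steiner symmetrization to balls\<close>

text \<open>
The sets \<open>X - K\<close> and \<open>K - X\<close> have equal measure. Some translation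
carries a fixed fraction of the square of that measure from the first into the second, and
symmetrization in the direction of this translation gains that much.
\<close>
lemma exists_improving_direction:
  fixes X :: "'a::euclidean_space set" and \<rho> R :: real
  defines "K \<equiv> cball (0::'a) \<rho>"
  assumes [measurable]: "X \<in> sets borel" and X: "X \<subseteq> cball 0 R" and K: "K \<subseteq> cball 0 R" and R: "0 < R"
    and eq: "emeasure lborel X = emeasure lborel K"
  shows "\<exists>u. norm u = 1 \<and> measure lborel (steiner u X - K)
    \<le> measure lborel (X - K) - (measure lborel (X - K))\<^sup>2 / (2 * measure lborel (cball (0::'a) (2 * R)))"
proof -
  let ?V = "measure lborel (cball (0::'a) (2 * R))"
  have [measurable]: "K \<in> sets borel" by (simp add: K_def)
  have V: "0 < ?V" using R by (simp add: content_cball_pos)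
  have bX: "bounded X" using X bounded_subset[OF bounded_cball] by blast
  have fin: "emeasure lborel S = ennreal (measure lborel S)" if "S \<subseteq> cball 0 R" for S :: "'a set"
    by (rule emeasure_bounded_eq_measure[OF bounded_subset[OF bounded_cball that]])
  have mPQ: "measure lborel (K - X) = measure lborel (X - K)"
    by (rule measure_Diff_commute_bounded) (use bX eq in \<open>auto simp: K_def\<close>)
  obtain z where z: "measure lborel (X - K) * measure lborel (K - X)
      \<le> 2 * ?V * measure lborel {x \<in> X - K. x + z \<in> K - X}"
    using exists_translate_overlap[of "X - K" "K - X" R] X K R by auto
  \<comment> \<open>for \<open>z = 0\<close> the matched part is empty, so any direction serves\<close>
  obtain u s where u: "norm u = 1" and zs: "z = s *\<^sub>R u"
  proof (cases "z = 0")
    case True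
    obtain b :: 'a where "b \<in> Basis" using nonempty_Basis by blast
    then show ?thesis using True that[of b 0] by simp
  next
    case False
    then show ?thesis using that[of "z /\<^sub>R norm z" "norm z"] by simp
  qed
  have [measurable]: "steiner u X \<in> sets borel" by measurable
  have sub: "steiner u X - K \<subseteq> cball 0 R" "X - K \<subseteq> cball 0 R" "{x \<in> X - K. x + z \<in> K - X} \<subseteq> cball 0 R"
    using steiner_subset_cball[OF assms(2) X u] X by auto
  have "emeasure lborel (steiner u X - K) + emeasure lborel {x \<in> X - K. x + z \<in> K - X}
      \<le> emeasure lborel (X - K)"
    unfolding zs K_def by (rule steiner_deficit[OF assms(2) bX u])
  then have "measure lborel (steiner u X - K) + measure lborel {x \<in> X - K. x + z \<in> K - X}
      \<le> measure lborel (X - K)"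
    unfolding fin[OF sub(1)] fin[OF sub(2)] fin[OF sub(3)] by (simp add: ennreal_plus[symmetric] del: ennreal_plus)
  moreover have "(measure lborel (X - K))\<^sup>2 / (2 * ?V) \<le> measure lborel {x \<in> X - K. x + z \<in> K - X}"
    using z V by (simp add: mPQ power2_eq_square field_simps)
  ultimately show ?thesis using u by (intro exI[of _ u]) auto
qed

lemma measure_steiner_diff_le:
  fixes X :: "'a::euclidean_space set"
  assumes [measurable]: "X \<in> sets borel" and bX: "bounded X" and u: "norm u = 1"
  shows "measure lborel (steiner u X - cball 0 \<rho>) \<le> measure lborel (X - cball 0 \<rho>)"
proof -
  have "emeasure lborel (steiner u X - cball 0 \<rho>) \<le> emeasure lborel (X - cball 0 \<rho>)"
    by (rule order_trans[OF _ steiner_deficit[OF assms, of \<rho> 0]]) simp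
  moreover have "emeasure lborel (X - cball 0 \<rho>) < \<infinity>"
    by (rule emeasure_bounded_finite) (use bX in \<open>simp add: bounded_diff\<close>)
  ultimately show ?thesis unfolding measure_def by (intro enn2real_mono) auto
qed

text \<open>
Among all pairs in a fixed large ball that have the given measures and a truncated integral not
above the given one, the distance to the pair of balls has infimum 0: a pair close enough to a
positive infimum would be pushed below it by a symmetrization in the direction that improves the
worse of its two sets, which does no harm to the other. Continuity then transfers the bound to the
balls.
\<close>
lemma truncated_integral_balls_le_bounded:
  fixes A B :: "'a::euclidean_space set" and \<rho> \<sigma> :: real
  defines "K \<equiv> cball (0::'a) \<rho>" and "L \<equiv> cball (0::'a) \<sigma>"
  assumes [measurable]: "A \<in> sets borel" "B \<in> sets borel" and bd: "bounded A" "bounded B"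
    and mA: "emeasure lborel A = emeasure lborel K" and mB: "emeasure lborel B = emeasure lborel L"
  shows "truncated_integral \<tau> K L \<le> truncated_integral \<tau> A B"
proof -
  have [measurable]: "K \<in> sets borel" "L \<in> sets borel" by (simp_all add: K_def L_def)
  have "bounded (A \<union> B \<union> K \<union> L)" using bd by (simp add: K_def L_def)
  then obtain R where R: "0 < R" and sub: "A \<union> B \<union> K \<union> L \<subseteq> cball 0 R"
    using bounded_subset_ballD[of "A \<union> B \<union> K \<union> L" 0] ball_subset_cball[of 0] by blast
  define V where "V = measure lborel (cball (0::'a) (2 * R))"
  have V: "0 < V" unfolding V_def using R by (simp add: content_cball_pos)
  define P where "P X Y \<longleftrightarrow> X \<in> sets borel \<and> Y \<in> sets borel \<and> X \<subseteq> cball 0 R \<and> Y \<subseteq> cball 0 R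
    \<and> emeasure lborel X = emeasure lborel K \<and> emeasure lborel Y = emeasure lborel L
    \<and> truncated_integral \<tau> X Y \<le> truncated_integral \<tau> A B" for X Y :: "'a set"
  define d where "d X Y = measure lborel (X - K) + measure lborel (Y - L)" for X Y :: "'a set"
  have P0: "P A B" using sub mA mB by (auto simp: P_def)
  have Psteiner: "P (steiner u X) (steiner u Y)" if "P X Y" "norm u = 1" for X Y u
  proof -
    have "bounded X" "bounded Y" using that unfolding P_def
      by (auto intro: bounded_subset[OF bounded_cball])
    then show ?thesis
      using that steiner_subset_cball[of X R u] steiner_subset_cball[of Y R u]
        order_trans[OF truncated_integral_steiner_le[of X Y u \<tau>], of "truncated_integral \<tau> A B"]
      unfolding P_def by (simp add: emeasure_steiner sets_steiner)
  qed
  have improve: "\<exists>X' Y'. P X' Y' \<and> d X' Y' \<le> d X Y - (d X Y)\<^sup>2 / (8 * V)" if XY: "P X Y" for X Y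
  proof -
    have X: "X \<in> sets borel" "X \<subseteq> cball 0 R" "bounded X" "emeasure lborel X = emeasure lborel (cball (0::'a) \<rho>)"
      and Y: "Y \<in> sets borel" "Y \<subseteq> cball 0 R" "bounded Y" "emeasure lborel Y = emeasure lborel (cball (0::'a) \<sigma>)"
      using XY unfolding P_def K_def L_def by (auto intro: bounded_subset[OF bounded_cball])
    let ?x = "measure lborel (X - K)" and ?y = "measure lborel (Y - L)"
    \<comment> \<open>the larger deficit is at least half of the sum, whence the constant \<open>8 = 2 * 2\<^sup>2\<close>\<close>
    have sq: "(?x + ?y)\<^sup>2 / (8 * V) \<le> m\<^sup>2 / (2 * V)" if "(?x + ?y) / 2 \<le> m" for m
    proof -
      have "((?x + ?y) / 2)\<^sup>2 \<le> m\<^sup>2" using that by (intro power_mono) auto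
      then show ?thesis using V by (simp add: field_simps)
    qed
    have "\<exists>u. norm u = 1 \<and> d (steiner u X) (steiner u Y) \<le> d X Y - (d X Y)\<^sup>2 / (8 * V)"
    proof (cases "?y \<le> ?x")
      case True
      obtain u where u: "norm u = 1" "measure lborel (steiner u X - K) \<le> ?x - ?x\<^sup>2 / (2 * V)"
        using exists_improving_direction[OF X(1,2) _ R X(4)] sub unfolding K_def V_def by blast
      have "measure lborel (steiner u Y - L) \<le> ?y"
        unfolding L_def by (rule measure_steiner_diff_le[OF Y(1,3) u(1)])
      then show ?thesis using u sq[of ?x] True unfolding d_def by (intro exI[of _ u]) simp
    next
      case False
      obtain u where u: "norm u = 1" "measure lborel (steiner u Y - L) \<le> ?y - ?y\<^sup>2 / (2 * V)"
        using exists_improving_direction[OF Y(1,2) _ R Y(4)] sub unfolding L_def V_def by blast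
      have "measure lborel (steiner u X - K) \<le> ?x"
        unfolding K_def by (rule measure_steiner_diff_le[OF X(1,3) u(1)])
      then show ?thesis using u sq[of ?y] False unfolding d_def by (intro exI[of _ u]) simp
    qed
    then show ?thesis using Psteiner[OF XY] by blast
  qed
  define D where "D = {d X Y | X Y. P X Y}"
  have D: "D \<noteq> {}" "bdd_below D" using P0 by (auto simp: D_def d_def intro!: bdd_belowI[of _ 0])
  have "Inf D = 0"
  proof (rule ccontr)
    assume "Inf D \<noteq> 0"
    moreover have "0 \<le> Inf D" using D by (intro cInf_greatest) (auto simp: D_def d_def)
    ultimately have pos: "0 < Inf D" by simp
    then have "Inf D < Inf D + (Inf D)\<^sup>2 / (8 * V)" using V by simp
    then obtain m where m: "m \<in> D" "m < Inf D + (Inf D)\<^sup>2 / (8 * V)"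
      unfolding cInf_less_iff[OF D] by blast
    then obtain X Y where XY: "P X Y" "m = d X Y" by (auto simp: D_def)
    then obtain X' Y' where X': "P X' Y'" "d X' Y' \<le> m - m\<^sup>2 / (8 * V)" using improve by blast
    have "Inf D \<le> m" using m D by (simp add: cInf_lower)
    then have "(Inf D)\<^sup>2 / (8 * V) \<le> m\<^sup>2 / (8 * V)"
      using pos V by (intro divide_right_mono power_mono) auto
    moreover have "Inf D \<le> d X' Y'" using X' D by (intro cInf_lower) (auto simp: D_def)
    ultimately show False using m X' by simp
  qed
  define M where "M = measure lborel K + measure lborel L"
  have fin: "emeasure lborel S = ennreal (measure lborel S)" if "S \<subseteq> cball 0 R" for S :: "'a set"
    by (rule emeasure_bounded_eq_measure[OF bounded_subset[OF bounded_cball that]])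
  have close: "truncated_integral \<tau> K L \<le> truncated_integral \<tau> A B + ennreal (d X Y * M)" if XY: "P X Y" for X Y
  proof -
    have [measurable]: "X \<in> sets borel" "Y \<in> sets borel" using XY by (auto simp: P_def)
    have compl: "emeasure lborel (S' - S) = ennreal (measure lborel (S - S'))"
      if "S \<in> sets borel" "S' \<in> sets borel" "S \<subseteq> cball 0 R" "S' \<subseteq> cball 0 R"
        "emeasure lborel S = emeasure lborel S'" for S S' :: "'a set"
    proof -
      have b: "bounded S" "bounded S'" using that by (auto intro: bounded_subset[OF bounded_cball])
      have "emeasure lborel (S' - S) = ennreal (measure lborel (S' - S))" using that by (intro fin) auto
      also have "measure lborel (S' - S) = measure lborel (S - S')"
        by (rule measure_Diff_commute_bounded) (use that b in auto)
      finally show ?thesis .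
    qed
    have K: "emeasure lborel K = ennreal (measure lborel K)" "emeasure lborel L = ennreal (measure lborel L)"
      using sub by (auto intro: fin)
    have "truncated_integral \<tau> K L \<le> truncated_integral \<tau> X Y
        + (emeasure lborel (K - X) * emeasure lborel L + emeasure lborel X * emeasure lborel (L - Y))"
      by (rule truncated_integral_perturb) auto
    also have "emeasure lborel (K - X) = ennreal (measure lborel (X - K))"
      using XY sub by (intro compl) (auto simp: P_def)
    also have "emeasure lborel (L - Y) = ennreal (measure lborel (Y - L))"
      using XY sub by (intro compl) (auto simp: P_def)
    also have "emeasure lborel X = ennreal (measure lborel K)" using XY K by (simp add: P_def)
    also have "ennreal (measure lborel (X - K)) * emeasure lborel L
        + ennreal (measure lborel K) * ennreal (measure lborel (Y - L))
        = ennreal (measure lborel (X - K) * measure lborel L + measure lborel K * measure lborel (Y - L))"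
      by (simp add: K ennreal_mult)
    also have "\<dots> \<le> ennreal (d X Y * M)"
      by (intro ennreal_leI) (simp add: d_def M_def algebra_simps)
    finally have "truncated_integral \<tau> K L \<le> truncated_integral \<tau> X Y + ennreal (d X Y * M)" by (simp add: add_left_mono)
    also have "\<dots> \<le> truncated_integral \<tau> A B + ennreal (d X Y * M)"
      using XY by (intro add_right_mono) (simp add: P_def)
    finally show ?thesis .
  qed
  show ?thesis
  proof (rule ennreal_le_epsilon)
    fix e :: real assume e: "0 < e"
    have M: "0 \<le> M" by (simp add: M_def)
    have "Inf D < e / (M + 1)" using \<open>Inf D = 0\<close> e M by simp
    then obtain m where m: "m \<in> D" "m < e / (M + 1)"
      unfolding cInf_less_iff[OF D] by blast
    then obtain X Y where XY: "P X Y" "m = d X Y" by (auto simp: D_def)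
    have "0 \<le> m" using XY by (simp add: d_def)
    have "m * M \<le> m * (M + 1)" using \<open>0 \<le> m\<close> by (simp add: algebra_simps)
    also have "\<dots> \<le> e" using m M by (simp add: field_simps)
    finally have "truncated_integral \<tau> A B + ennreal (d X Y * M) \<le> truncated_integral \<tau> A B + ennreal e"
      using XY by (intro add_left_mono ennreal_leI) simp
    with close[OF XY(1)] show "truncated_integral \<tau> K L \<le> truncated_integral \<tau> A B + ennreal e" by (rule order_trans)
  qed
qed

lemma truncated_integral_mono:
  assumes "A' \<subseteq> A" "B' \<subseteq> B"
  shows "truncated_integral \<tau> A' B' \<le> truncated_integral \<tau> A B"
  unfolding truncated_integral_def conv_def using assms
  by (intro nn_integral_mono min.mono order_refl) (auto simp: indicator_def)

lemma ball_rearrangement_cball: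
  fixes E :: "'a::euclidean_space set"
  assumes [measurable]: "E \<in> sets borel"
  obtains r where "ball_rearrangement E = cball 0 r" "measure lborel (cball (0::'a) r) = measure lborel E"
proof -
  obtain r where r: "ball_rearrangement E = cball 0 r" unfolding ball_rearrangement_def by blast
  have "measure lborel (cball (0::'a) r) = measure lborel E"
    using measure_ball_rearrangement[of E] unfolding r by simp
  with r that show ?thesis by blast
qed

text \<open>
Exhausting the sets by bounded ones only lowers the truncated integral, and the rearranged balls
converge in measure.
\<close>
lemma truncated_integral_ball_rearrangement_le:
  fixes A B :: "'a::euclidean_space set"
  assumes [measurable]: "A \<in> sets borel" "B \<in> sets borel"
    and fin: "emeasure lborel A < \<infinity>" "emeasure lborel B < \<infinity>"
  shows "truncated_integral \<tau> (ball_rearrangement A) (ball_rearrangement B) \<le> truncated_integral \<tau> A B"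
proof -
  let ?a = "measure lborel A" and ?b = "measure lborel B"
  define An where "An n = A \<inter> cball 0 (real n)" for n
  define Bn where "Bn n = B \<inter> cball 0 (real n)" for n
  have [measurable]: "An n \<in> sets borel" "Bn n \<in> sets borel" for n by (auto simp: An_def Bn_def)
  have un: "(\<Union>n. S \<inter> cball 0 (real n)) = S" for S :: "'a set"
    using real_arch_simple by auto
  have exhaust: "(\<lambda>n. measure lborel (S \<inter> cball 0 (real n))) \<longlonglongrightarrow> measure lborel S"
    if [measurable]: "S \<in> sets borel" and "emeasure lborel S < \<infinity>" for S :: "'a set"
  proof -
    have "(\<lambda>n. measure lborel (S \<inter> cball 0 (real n))) \<longlonglongrightarrow> measure lborel (\<Union>n. S \<inter> cball 0 (real n))"
    proof (rule Lim_measure_incseq)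
      show "incseq (\<lambda>n. S \<inter> cball 0 (real n))" by (auto simp: incseq_def)
      show "emeasure lborel (\<Union>n. S \<inter> cball 0 (real n)) \<noteq> \<infinity>" unfolding un using that by simp
    qed auto
    then show ?thesis by (simp only: un)
  qed
  have ball_fin: "emeasure lborel (cball (0::'a) r) = ennreal (measure lborel (cball (0::'a) r))" for r
    by (simp add: emeasure_bounded_eq_measure)
  have diff: "emeasure lborel (ball_rearrangement S - ball_rearrangement T)
      \<le> ennreal (measure lborel S - measure lborel T)"
    if S: "S \<in> sets borel" and T: "T \<in> sets borel" and sub: "T \<subseteq> S" for S T :: "'a set"
  proof -
    obtain r where r: "ball_rearrangement S = cball 0 r" "measure lborel (cball (0::'a) r) = measure lborel S"
      by (rule ball_rearrangement_cball[OF S])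
    obtain q where q: "ball_rearrangement T = cball 0 q" "measure lborel (cball (0::'a) q) = measure lborel T"
      by (rule ball_rearrangement_cball[OF T])
    show ?thesis
    proof (cases "r \<le> q")
      case True
      then have "ball_rearrangement S - ball_rearrangement T = {}" using r q by auto
      then show ?thesis by (simp only: emeasure_empty zero_le)
    next
      case False
      then have "cball (0::'a) q \<subseteq> cball 0 r" by auto
      then have "emeasure lborel (cball (0::'a) r - cball 0 q)
          = emeasure lborel (cball (0::'a) r) - emeasure lborel (cball (0::'a) q)"
        by (intro emeasure_Diff) (auto simp: emeasure_lborel_cball_finite less_top[symmetric] ball_fin)
      then show ?thesis by (simp add: r q ball_fin ennreal_minus)
    qed
  qed
  have fA: "measure lborel (An n) \<le> ?a" "measure lborel (Bn n) \<le> ?b" for n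
    unfolding An_def Bn_def using fin by (auto intro!: measure_mono_fmeasurable simp: fmeasurable_def)
  have step: "truncated_integral \<tau> (ball_rearrangement A) (ball_rearrangement B) \<le> truncated_integral \<tau> A B
      + ennreal ((?a - measure lborel (An n)) * ?b + ?a * (?b - measure lborel (Bn n)))" for n
  proof -
    let ?KA = "ball_rearrangement A" and ?KB = "ball_rearrangement B"
    let ?Kn = "ball_rearrangement (An n)" and ?Ln = "ball_rearrangement (Bn n)"
    obtain r where r: "?Kn = cball 0 r" "measure lborel (cball (0::'a) r) = measure lborel (An n)"
      by (rule ball_rearrangement_cball[of "An n"]) auto
    obtain q where q: "?Ln = cball 0 q" "measure lborel (cball (0::'a) q) = measure lborel (Bn n)"
      by (rule ball_rearrangement_cball[of "Bn n"]) auto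
    obtain r' where r': "?KA = cball 0 r'" "measure lborel (cball (0::'a) r') = ?a"
      by (rule ball_rearrangement_cball[OF assms(1)])
    obtain q' where q': "?KB = cball 0 q'" "measure lborel (cball (0::'a) q') = ?b"
      using ball_rearrangement_cball[OF assms(2)] .
    have bd: "bounded (An n)" "bounded (Bn n)" by (auto simp: An_def Bn_def)
    have "truncated_integral \<tau> ?Kn ?Ln \<le> truncated_integral \<tau> (An n) (Bn n)" unfolding r q
      by (rule truncated_integral_balls_le_bounded)
        (use bd bd[THEN emeasure_bounded_neq_top] r q in \<open>auto simp: ball_fin emeasure_eq_ennreal_measure\<close>)
    also have "\<dots> \<le> truncated_integral \<tau> A B" by (rule truncated_integral_mono) (auto simp: An_def Bn_def)
    finally have 1: "truncated_integral \<tau> ?Kn ?Ln \<le> truncated_integral \<tau> A B" .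
    have "truncated_integral \<tau> ?KA ?KB \<le> truncated_integral \<tau> ?Kn ?Ln
        + (emeasure lborel (?KA - ?Kn) * emeasure lborel ?KB + emeasure lborel ?Kn * emeasure lborel (?KB - ?Ln))"
      by (rule truncated_integral_perturb) (auto simp: r q r' q')
    also have "\<dots> \<le> truncated_integral \<tau> A B + (ennreal (?a - measure lborel (An n)) * ennreal ?b
        + ennreal ?a * ennreal (?b - measure lborel (Bn n)))"
    proof (intro add_mono mult_mono 1)
      show "emeasure lborel (?KA - ?Kn) \<le> ennreal (?a - measure lborel (An n))"
        by (rule diff) (auto simp: An_def)
      show "emeasure lborel (?KB - ?Ln) \<le> ennreal (?b - measure lborel (Bn n))"
        by (rule diff) (auto simp: Bn_def)
      show "emeasure lborel ?KB \<le> ennreal ?b" by (simp add: q' ball_fin)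
      show "emeasure lborel ?Kn \<le> ennreal ?a" using fA by (simp add: r ball_fin ennreal_leI)
    qed auto
    also have "ennreal (?a - measure lborel (An n)) * ennreal ?b
        + ennreal ?a * ennreal (?b - measure lborel (Bn n))
        = ennreal ((?a - measure lborel (An n)) * ?b + ?a * (?b - measure lborel (Bn n)))"
      using fA[of n] by (simp add: ennreal_mult)
    finally show ?thesis .
  qed
  have "(\<lambda>n. (?a - measure lborel (An n)) * ?b + ?a * (?b - measure lborel (Bn n)))
      \<longlonglongrightarrow> (?a - ?a) * ?b + ?a * (?b - ?b)"
    unfolding An_def Bn_def by (intro tendsto_intros exhaust fin) auto
  then have lim: "(\<lambda>n. (?a - measure lborel (An n)) * ?b + ?a * (?b - measure lborel (Bn n))) \<longlonglongrightarrow> 0"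
    by simp
  show ?thesis
  proof (rule ennreal_le_epsilon)
    fix e :: real assume "0 < e"
    then have "eventually (\<lambda>n. (?a - measure lborel (An n)) * ?b + ?a * (?b - measure lborel (Bn n)) < e) sequentially"
      by (rule order_tendstoD[OF lim])
    then obtain n where n: "(?a - measure lborel (An n)) * ?b + ?a * (?b - measure lborel (Bn n)) < e"
      by (auto simp: eventually_sequentially)
    show "truncated_integral \<tau> (ball_rearrangement A) (ball_rearrangement B) \<le> truncated_integral \<tau> A B + ennreal e"
      by (rule order_trans[OF step[of n]]) (use n in \<open>auto intro!: add_left_mono ennreal_leI\<close>)
  qed
qed

section \<open>Bochner integrals and Lebesgue measurable sets\<close>

lemma conv_finite:
  assumes [measurable]: "A \<in> sets borel" "B \<in> sets borel" and "emeasure lborel B < \<infinity>"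
  shows "conv A B z < \<infinity>"
proof -
  have "conv A B z \<le> (\<integral>\<^sup>+y. indicator B y \<partial>lborel)" unfolding conv_def
    by (intro nn_integral_mono) (auto simp: indicator_def)
  then show ?thesis using assms(3) by (simp add: le_less_trans)
qed

lemma convolve_indicator:
  assumes [measurable]: "A \<in> sets borel" "B \<in> sets borel"
  shows "convolve (indicat_real A) (indicat_real B) z = enn2real (conv A B z)"
proof -
  have "convolve (indicat_real A) (indicat_real B) z = (LINT y|lborel. indicat_real A (z - y) * indicat_real B y)"
    unfolding convolve_def by (rule integral_completion) measurable
  also have "\<dots> = enn2real (\<integral>\<^sup>+y. ennreal (indicat_real A (z - y) * indicat_real B y) \<partial>lborel)"
    by (rule integral_eq_nn_integral) auto
  also have "(\<integral>\<^sup>+y. ennreal (indicat_real A (z - y) * indicat_real B y) \<partial>lborel) = conv A B z"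
    unfolding conv_def by (intro nn_integral_cong) (auto simp: indicator_def)
  finally show ?thesis .
qed

lemma integral_min_convolve:
  assumes [measurable]: "A \<in> sets borel" "B \<in> sets borel" and fin: "emeasure lborel B < \<infinity>"
    and t: "0 \<le> \<tau>"
  shows "(LINT x|lebesgue. min (convolve (indicat_real A) (indicat_real B) x) \<tau>) = enn2real (truncated_integral (ennreal \<tau>) A B)"
proof -
  have "(LINT x|lebesgue. min (convolve (indicat_real A) (indicat_real B) x) \<tau>)
      = (LINT x|lborel. min (enn2real (conv A B x)) \<tau>)"
    unfolding convolve_indicator[OF assms(1,2)] by (rule integral_completion) measurable
  also have "\<dots> = enn2real (\<integral>\<^sup>+x. ennreal (min (enn2real (conv A B x)) \<tau>) \<partial>lborel)"
    by (rule integral_eq_nn_integral) (use t in auto)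
  also have "(\<integral>\<^sup>+x. ennreal (min (enn2real (conv A B x)) \<tau>) \<partial>lborel) = truncated_integral (ennreal \<tau>) A B"
    unfolding truncated_integral_def
  proof (rule nn_integral_cong)
    fix x
    show "ennreal (min (enn2real (conv A B x)) \<tau>) = min (conv A B x) (ennreal \<tau>)"
      using conv_finite[OF assms(1,2) fin, of x] t by (cases "conv A B x") (auto simp: min_def ennreal_le_iff)
  qed
  finally show ?thesis .
qed

lemma truncated_integral_finite:
  assumes [measurable]: "A \<in> sets borel" "B \<in> sets borel"
    and "emeasure lborel A < \<infinity>" "emeasure lborel B < \<infinity>"
  shows "truncated_integral \<tau> A B < \<infinity>"
proof -
  have "truncated_integral \<tau> A B \<le> emeasure lborel A * emeasure lborel B"
    unfolding truncated_integral_def nn_integral_conv[OF assms(1,2), symmetric] by (intro nn_integral_mono) auto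
  also have "\<dots> < \<infinity>" using assms(3,4) by (simp add: ennreal_mult_less_top)
  finally show ?thesis .
qed

lemma lebesgue_inner_borel:
  assumes "E \<in> sets lebesgue"
  obtains S N where "S \<in> sets borel" "N \<in> null_sets lborel" "S \<subseteq> E" "E \<subseteq> S \<union> N"
proof -
  obtain S N N' where "E = S \<union> N" "N \<subseteq> N'" "N' \<in> null_sets lborel" "S \<in> sets lborel"
    using sets_completionE[OF assms] .
  then show ?thesis using that[of S N'] by auto
qed

lemma lebesgue_eq_inner_borel:
  assumes S: "S \<in> sets borel" and N: "N \<in> null_sets lborel" and "S \<subseteq> E" "E \<subseteq> S \<union> N"
  shows "measure lebesgue E = measure lborel S" "emeasure lebesgue E = emeasure lborel S"
proof -
  have E: "E = S \<union> (E - S)" using assms by auto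
  have "E - S \<subseteq> N" using assms by auto
  then have null: "E - S \<in> null_sets lebesgue"
    using N by (auto intro: null_sets_completion_subset null_sets_completionI)
  show "measure lebesgue E = measure lborel S"
    by (subst E, subst measure_Un_null_set) (use S null in auto)
  show "emeasure lebesgue E = emeasure lborel S"
    by (subst E, subst emeasure_Un_null_set) (use S null in auto)
qed

lemma null_sets_reflect:
  fixes N :: "'a::euclidean_space set"
  assumes N: "N \<in> null_sets lborel"
  shows "{y. z - y \<in> N} \<in> null_sets lborel"
proof -
  have [measurable]: "N \<in> sets borel" using N by auto
  have "{y. z - y \<in> N} \<in> sets borel" by measurable
  then show ?thesis using N emeasure_lborel_reflect[of N z] by (auto simp: null_sets_def)
qed

text \<open>
Even at each single point \<open>z\<close> the convolution ignores null sets, since reflections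
and translations of null sets are null.
\<close>
lemma convolve_inner_borel:
  fixes E F :: "'a::euclidean_space set"
  assumes [measurable]: "S \<in> sets borel" "T \<in> sets borel"
    and N: "N \<in> null_sets lborel" "S \<subseteq> E" "E \<subseteq> S \<union> N"
    and M: "M \<in> null_sets lborel" "T \<subseteq> F" "F \<subseteq> T \<union> M"
  shows "convolve (indicat_real E) (indicat_real F) z = convolve (indicat_real S) (indicat_real T) z"
proof -
  have ind: "convolve (indicat_real X) (indicat_real Y) z = measure lebesgue {y \<in> Y. z - y \<in> X}"
    for X Y :: "'a set"
  proof -
    have "convolve (indicat_real X) (indicat_real Y) z = (LINT y|lebesgue. indicat_real {y \<in> Y. z - y \<in> X} y)"
      unfolding convolve_def by (intro Bochner_Integration.integral_cong) (auto simp: indicator_def)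
    then show ?thesis by simp
  qed
  have "measure lebesgue {y \<in> F. z - y \<in> E} = measure lborel {y \<in> T. z - y \<in> S}"
    by (rule lebesgue_eq_inner_borel(1)[where N = "{y. z - y \<in> N} \<union> M"])
      (use N M null_sets_reflect[OF N(1), of z] in \<open>auto intro: null_sets.Un\<close>)
  moreover have "{y \<in> T. z - y \<in> S} \<in> sets borel" by measurable
  ultimately show ?thesis unfolding ind by simp
qed

theorem theorem3:
  fixes E1 E2 :: "(real ^ 'n) set" and \<tau> :: real
  assumes "E1 \<in> sets lebesgue" and "emeasure lebesgue E1 < \<infinity>"
    and "E2 \<in> sets lebesgue" and "emeasure lebesgue E2 < \<infinity>"
    and "\<tau> > 0"
  shows "(LINT x|lebesgue. min (convolve (indicat_real E1) (indicat_real E2) x) \<tau>)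
    \<ge> (LINT x|lebesgue. min (convolve (indicat_real (ball_rearrangement E1))
                                     (indicat_real (ball_rearrangement E2)) x) \<tau>)"
proof -
  obtain S N where S[measurable]: "S \<in> sets borel" and N: "N \<in> null_sets lborel" "S \<subseteq> E1" "E1 \<subseteq> S \<union> N"
    using lebesgue_inner_borel[OF assms(1)] .
  obtain T M where T[measurable]: "T \<in> sets borel" and M: "M \<in> null_sets lborel" "T \<subseteq> E2" "E2 \<subseteq> T \<union> M"
    using lebesgue_inner_borel[OF assms(3)] .
  have fin: "emeasure lborel S < \<infinity>" "emeasure lborel T < \<infinity>"
    using lebesgue_eq_inner_borel(2)[OF S N] lebesgue_eq_inner_borel(2)[OF T M] assms(2,4) by simp_all
  have rearr: "ball_rearrangement E1 = ball_rearrangement S" "ball_rearrangement E2 = ball_rearrangement T"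
    unfolding ball_rearrangement_def lebesgue_eq_inner_borel(1)[OF S N] lebesgue_eq_inner_borel(1)[OF T M]
    by simp_all
  have ball: "ball_rearrangement X \<in> sets borel" "emeasure lborel (ball_rearrangement X) < \<infinity>"
    for X :: "(real ^ 'n) set"
    unfolding ball_rearrangement_def using emeasure_bounded_finite[OF bounded_cball] by auto
  have "enn2real (truncated_integral (ennreal \<tau>) (ball_rearrangement S) (ball_rearrangement T))
      \<le> enn2real (truncated_integral (ennreal \<tau>) S T)"
    using truncated_integral_ball_rearrangement_le[OF S T fin] truncated_integral_finite[OF S T fin]
    by (intro enn2real_mono) auto
  moreover have "0 \<le> \<tau>" using assms(5) by simp
  ultimately show ?thesis
    unfolding convolve_inner_borel[OF S T N M] rearr
    by (simp only: integral_min_convolve[OF S T fin(2)]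
        integral_min_convolve[OF ball(1) ball(1) ball(2)])
qed

end
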